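(* Let $\alpha_0,\dots,\alpha_4$ be complex parameters with $\alpha_0+\alpha_1+\alpha_2+\alpha_3+\alpha_4=1$, and consider the Hamiltonian system $$\frac{dx}{dt}=\frac{\partial H}{\partial y},\ \frac{dy}{dt}=-\frac{\partial H}{\partial x},\ \frac{dz}{dt}=\frac{\partial H}{\partial w},\ \frac{dw}{dt}=-\frac{\partial H}{\partial z},\ \frac{dq}{dt}=\frac{\partial H}{\partial p},\ \frac{dp}{dt}=-\frac{\partial H}{\partial q}$$ with $$\begin{aligned}H={}&\frac{x^2y^2+2\alpha_0xy+x}{2t}+\frac{z^2w^2+2(\alpha_0+\alpha_1+\alpha_2)zw}{2t}+\frac{q^2p^2+2(\alpha_4-1)qp-tq}{2t}\\&+\frac{yz(zw+\alpha_2)}{t}-\frac{(y+w)p}{t}.\end{aligned}$$ This system admits extended affine Weyl group symmetry of type $D_5^{(2)}$ as a group of Bäcklund transformations, with generators given, in the notation $( * ):=(x,y,z,w,q,p,t;\alpha_0,\dots,\alpha_4)$, by $$\begin{aligned} s_0:( * )&\to\left(-x-\tfrac{2\alpha_0}{y}-\tfrac{1}{y^2},-y,-z,-w,-q,-p,-t;-\alpha_0,\alpha_1+2\alpha_0,\alpha_2,\alpha_3,\alpha_4\right),\\ s_1:( * )&\to\left(x,y-\tfrac{\alpha_1}{x-z},z,w+\tfrac{\alpha_1}{x-z},q,p,t;\alpha_0+\alpha_1,-\alpha_1,\alpha_2+\alpha_1,\alpha_3,\alpha_4\right),\\ s_2:( * )&\to\left(x,y,z+\tfrac{\alpha_2}{w},w,q,p,t;\alpha_0,\alpha_1+\alpha_2,-\alpha_2,\alpha_3+\alpha_2,\alpha_4\right),\\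 s_3:( * )&\to\left(x,y,z,w-\tfrac{\alpha_3q}{zq-1},q,p-\tfrac{\alpha_3z}{zq-1},t;\alpha_0,\alpha_1,\alpha_2+\alpha_3,-\alpha_3,\alpha_4+\alpha_3\right),\\ s_4:( * )&\to\left(x,y,z,w,q+\tfrac{2\alpha_4}{p}-\tfrac{t}{p^2},p,-t;\alpha_0,\alpha_1,\alpha_2,\alpha_3+2\alpha_4,-\alpha_4\right),\\ \pi:( * )&\to\left(-tq,-\tfrac{p}{t},-\tfrac{t}{z},\tfrac{(zw+\alpha_2)z}{t},-\tfrac{x}{t},-ty,t;\alpha_4,\alpha_3,\alpha_2,\alpha_1,\alpha_0\right). \end{aligned}$$ That is: each of $s_0,\dots,s_4,\pi$ is a Bäcklund transformation of the system; $s_0,\dots,s_4$ satisfy the defining relations of the affine Weyl group of type $D_5^{(2)}$; and $\pi$ acts on them as an automorphism of the Dynkin diagram.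
   Context: The unknowns are complex functions $x,y,z,w,q,p$ of $t$. A Bäcklund transformation of the system is a birational transformation $s$ of $(x,y,z,w,q,p,t)$ (rational in the parameters; here $s(t)=\pm t$), together with an affine transformation of the parameters, that maps the system to itself: whenever $(x,\dots,p)$ solves the system with parameters $\alpha_i$, the functions $s(x),\dots,s(p)$, as functions of $s(t)$, solve the same system with $\alpha_i$ replaced by $s(\alpha_i)$. Transformations act as automorphisms of the field of rational functions in $x,y,z,w,q,p,t,\alpha_i$ and products are compositions. Dynkin diagram of type $D_5^{(2)}$: nodes $0,\dots,4$ in a chain, with double edges between $0,1$ and between $3,4$, and simple edges $1-2,\ 2-3$. Defining relations of the affine Weyl group: $s_i^2=1$; $(s_0s_1)^4=(s_3s_4)^4=1$; $(s_1s_2)^3=(s_2s_3)^3=1$; $(s_is_j)^2=1$ for $|i-j|\ge2$. The transformation $\pi$ acts by $\pi s_i\pi^{-1}=s_{4-i}$. *)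

theory Defs
  imports
    "HOL-Analysis.Analysis"
    "HOL-Library.Poly_Mapping"
    "HOL-Computational_Algebra.Fraction_Field"
begin

section \<open>The Hamiltonian system\<close>

definition hamiltonian ::
  "(nat \<Rightarrow> complex) \<Rightarrow> complex \<Rightarrow> complex \<Rightarrow> complex \<Rightarrow> complex \<Rightarrow> complex \<Rightarrow> complex \<Rightarrow> complex \<Rightarrow> complex"
  where
  "hamiltonian a t x y z w q p =
     (x^2 * y^2 + 2 * a 0 * x * y + x) / (2 * t)
   + (z^2 * w^2 + 2 * (a 0 + a 1 + a 2) * z * w) / (2 * t)
   + (q^2 * p^2 + 2 * (a 4 - 1) * q * p - t * q) / (2 * t)
   + y * z * (z * w + a 2) / t
   - (y + w) * p / t"

text \<open>
  A solution is a family of six holomorphic functions on a nonempty open set of times that avoids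
  the pole \<open>t = 0\<close> of the Hamiltonian. The parameters are \<open>a 0, \<dots>, a 4\<close>; other values of \<open>a\<close>
  play no role.
\<close>

definition solves ::
  "(nat \<Rightarrow> complex) \<Rightarrow> complex set \<Rightarrow> (complex \<Rightarrow> complex) \<Rightarrow> (complex \<Rightarrow> complex) \<Rightarrow>
   (complex \<Rightarrow> complex) \<Rightarrow> (complex \<Rightarrow> complex) \<Rightarrow> (complex \<Rightarrow> complex) \<Rightarrow> (complex \<Rightarrow> complex) \<Rightarrow> bool"
  where
  "solves a S x y z w q p \<longleftrightarrow>
     (\<Sum>i\<le>4. a i) = 1 \<and> open S \<and> S \<noteq> {} \<and> 0 \<notin> S \<and>
     (\<forall>t\<in>S.
        (x has_field_derivative
           deriv (\<lambda>v. hamiltonian a t (x t) v (z t) (w t) (q t) (p t)) (y t)) (at t) \<and>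
        (y has_field_derivative
           - deriv (\<lambda>v. hamiltonian a t v (y t) (z t) (w t) (q t) (p t)) (x t)) (at t) \<and>
        (z has_field_derivative
           deriv (\<lambda>v. hamiltonian a t (x t) (y t) (z t) v (q t) (p t)) (w t)) (at t) \<and>
        (w has_field_derivative
           - deriv (\<lambda>v. hamiltonian a t (x t) (y t) v (w t) (q t) (p t)) (z t)) (at t) \<and>
        (q has_field_derivative
           deriv (\<lambda>v. hamiltonian a t (x t) (y t) (z t) (w t) (q t) v) (p t)) (at t) \<and>
        (p has_field_derivative
           - deriv (\<lambda>v. hamiltonian a t (x t) (y t) (z t) (w t) v (p t)) (q t)) (at t))"


section \<open>The field of rational functions\<close>

text \<open>
  Since the parameters satisfy \<open>\<alpha>\<^sub>0 + \<dots> + \<alpha>\<^sub>4 = 1\<close>, the field of rational functions in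
  \<open>x, y, z, w, q, p, t\<close> and the \<open>\<alpha>\<^sub>i\<close> is the rational function field over the complex numbers
  in the eleven independent variables below, with \<open>\<alpha>\<^sub>4 = 1 - \<alpha>\<^sub>0 - \<alpha>\<^sub>1 - \<alpha>\<^sub>2 - \<alpha>\<^sub>3\<close>.
\<close>

datatype var = VX | VY | VZ | VW | VQ | VP | VT | VA0 | VA1 | VA2 | VA3

text \<open>
  The order on the variables is arbitrary; it is needed only because the library obtains the
  integral domain instance for polynomials from a linear order on the exponents.
\<close>

primrec var_index :: "var \<Rightarrow> nat" where
  "var_index VX = 0"
| "var_index VY = 1"
| "var_index VZ = 2"
| "var_index VW = 3"
| "var_index VQ = 4"
| "var_index VP = 5"
| "var_index VT = 6"
| "var_index VA0 = 7"
| "var_index VA1 = 8"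
| "var_index VA2 = 9"
| "var_index VA3 = 10"

instantiation var :: linorder
begin

definition less_eq_var :: "var \<Rightarrow> var \<Rightarrow> bool" where
  "less_eq_var u v \<longleftrightarrow> var_index u \<le> var_index v"

definition less_var :: "var \<Rightarrow> var \<Rightarrow> bool" where
  "less_var u v \<longleftrightarrow> var_index u < var_index v"

instance
proof
  fix u v :: var
  assume "u \<le> v" "v \<le> u"
  then have "var_index u = var_index v"
    by (simp add: less_eq_var_def)
  then show "u = v"
    by (cases u; cases v) simp_all
qed (auto simp: less_eq_var_def less_var_def)

end

type_synonym polynomial = "(var \<Rightarrow>\<^sub>0 nat) \<Rightarrow>\<^sub>0 complex"
type_synonym ratfun = "polynomial fract"

definition rf_const :: "complex \<Rightarrow> ratfun" where
  "rf_const c = Fract (Poly_Mapping.single 0 c) 1"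

definition rf_var :: "var \<Rightarrow> ratfun" where
  "rf_var v = Fract (Poly_Mapping.single (Poly_Mapping.single v 1) 1) 1"

definition rf_par :: "nat \<Rightarrow> ratfun" where
  "rf_par i =
     (if i = 0 then rf_var VA0
      else if i = 1 then rf_var VA1
      else if i = 2 then rf_var VA2
      else if i = 3 then rf_var VA3
      else 1 - rf_var VA0 - rf_var VA1 - rf_var VA2 - rf_var VA3)"

definition poly_value :: "(var \<Rightarrow> complex) \<Rightarrow> polynomial \<Rightarrow> complex" where
  "poly_value \<rho> f =
     (\<Sum>m\<in>Poly_Mapping.keys f.
        Poly_Mapping.lookup f m * (\<Prod>v\<in>Poly_Mapping.keys m. \<rho> v ^ Poly_Mapping.lookup m v))"

text \<open>
  The rational function \<open>f\<close> is defined at the point \<open>\<rho>\<close> and takes the value \<open>c\<close> there: some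
  representation of \<open>f\<close> as a quotient of polynomials has a denominator that does not vanish
  at \<open>\<rho>\<close>. The value does not depend on the representation.
\<close>

definition rf_has_value :: "ratfun \<Rightarrow> (var \<Rightarrow> complex) \<Rightarrow> complex \<Rightarrow> bool" where
  "rf_has_value f \<rho> c \<longleftrightarrow>
     (\<exists>n d. f = Fract n d \<and> poly_value \<rho> d \<noteq> 0 \<and> c = poly_value \<rho> n / poly_value \<rho> d)"

fun point ::
  "complex \<Rightarrow> complex \<Rightarrow> complex \<Rightarrow> complex \<Rightarrow> complex \<Rightarrow> complex \<Rightarrow> complex \<Rightarrow> (nat \<Rightarrow> complex) \<Rightarrow> var \<Rightarrow> complex"
  where
  "point x y z w q p t a VX = x"
| "point x y z w q p t a VY = y"
| "point x y z w q p t a VZ = z"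
| "point x y z w q p t a VW = w"
| "point x y z w q p t a VQ = q"
| "point x y z w q p t a VP = p"
| "point x y z w q p t a VT = t"
| "point x y z w q p t a VA0 = a 0"
| "point x y z w q p t a VA1 = a 1"
| "point x y z w q p t a VA2 = a 2"
| "point x y z w q p t a VA3 = a 3"


section \<open>Baecklund transformations\<close>

definition field_automorphism :: "(ratfun \<Rightarrow> ratfun) \<Rightarrow> bool" where
  "field_automorphism \<sigma> \<longleftrightarrow>
     bij \<sigma> \<and>
     (\<forall>f g. \<sigma> (f + g) = \<sigma> f + \<sigma> g) \<and>
     (\<forall>f g. \<sigma> (f * g) = \<sigma> f * \<sigma> g) \<and>
     (\<forall>c. \<sigma> (rf_const c) = rf_const c)"

text \<open>
  The images of the generators. They determine an automorphism over the complex numbers uniquely.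
\<close>

definition acts_by :: "(ratfun \<Rightarrow> ratfun) \<Rightarrow> ratfun list \<Rightarrow> ratfun list \<Rightarrow> bool" where
  "acts_by \<sigma> us as \<longleftrightarrow>
     map (\<lambda>v. \<sigma> (rf_var v)) [VX, VY, VZ, VW, VQ, VP, VT] = us \<and>
     map (\<lambda>i. \<sigma> (rf_par i)) [0, 1, 2, 3, 4] = as"

definition affine_on_parameters :: "(ratfun \<Rightarrow> ratfun) \<Rightarrow> bool" where
  "affine_on_parameters \<sigma> \<longleftrightarrow>
     (\<exists>c m. \<forall>i\<le>4. \<sigma> (rf_par i) = rf_const (c i) + (\<Sum>j\<le>4. rf_const (m i j) * rf_par j))"

text \<open>
  In the last clause \<open>x, \<dots>, p\<close> is a solution on \<open>S\<close> along which all the images \<open>\<sigma>(x), \<dots>, \<sigma>(p)\<close>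
  are defined, \<open>\<tau>\<close> is the new time \<open>\<sigma>(t)\<close> as a function of the old one, and \<open>x', \<dots>, p'\<close> are
  \<open>\<sigma>(x), \<dots>, \<sigma>(p)\<close> along the solution, as functions of \<open>\<sigma>(t)\<close>; \<open>a'\<close> are the new parameters.
\<close>

definition baecklund_transformation :: "(ratfun \<Rightarrow> ratfun) \<Rightarrow> bool" where
  "baecklund_transformation \<sigma> \<longleftrightarrow>
     field_automorphism \<sigma> \<and>
     (\<sigma> (rf_var VT) = rf_var VT \<or> \<sigma> (rf_var VT) = - rf_var VT) \<and>
     affine_on_parameters \<sigma> \<and>
     (\<forall>a S x y z w q p a' \<tau> x' y' z' w' q' p'.
        solves a S x y z w q p \<longrightarrow>
        (\<forall>t\<in>S. let \<rho> = point (x t) (y t) (z t) (w t) (q t) (p t) t a in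
           rf_has_value (\<sigma> (rf_var VX)) \<rho> (x' (\<tau> t)) \<and>
           rf_has_value (\<sigma> (rf_var VY)) \<rho> (y' (\<tau> t)) \<and>
           rf_has_value (\<sigma> (rf_var VZ)) \<rho> (z' (\<tau> t)) \<and>
           rf_has_value (\<sigma> (rf_var VW)) \<rho> (w' (\<tau> t)) \<and>
           rf_has_value (\<sigma> (rf_var VQ)) \<rho> (q' (\<tau> t)) \<and>
           rf_has_value (\<sigma> (rf_var VP)) \<rho> (p' (\<tau> t)) \<and>
           rf_has_value (\<sigma> (rf_var VT)) \<rho> (\<tau> t) \<and>
           (\<forall>i\<le>4. rf_has_value (\<sigma> (rf_par i)) \<rho> (a' i))) \<longrightarrow>
        solves a' (\<tau> ` S) x' y' z' w' q' p')"

end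

theory Submission
  imports Defs
begin

text \<open>
  The listed images define a substitution of rational functions. Each of the six substitutions
  squares to the identity on the variables, and this alone makes it an involutive automorphism of the
  field (\<open>involutive_substitution\<close>): a polynomial sent to zero would be returned as zero by the second
  application. An automorphism is determined by the images of the variables (\<open>ratfun_hom_eqI\<close>), so
  every group relation is a finite list of identities between rational functions.

  For involutions \<open>a\<close> and \<open>b\<close>, the relation \<open>(a b)^k = 1\<close> is the braid relation with \<open>k\<close> alternating
  factors on each side. The two substantial ones, \<open>s1_s2_braid\<close> and \<open>s0_s1_braid\<close>, become short
  computations once expressed in elements on which the reflections act by shifts or by monomials. The
  transformation \<open>\<pi>\<close>, called \<open>flip\<close> below, is an involution too, and conjugating by it transports these
  relations to the other half of the diagram.

  Along a solution, the images of the coordinates satisfy the system with the new parameters because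
  the Hamiltonian vector field is mapped to itself; these are the identities \<open>velocity_s0\<close> to
  \<open>velocity_flip\<close>. They need the denominators to be nonzero along the solution. All that is known is
  that each transformed coordinate has a value in the sense that some representation as a fraction has
  a nonvanishing denominator, and \<open>no_value_at_pole\<close> shows that then the obvious denominator does not
  vanish either.
\<close>

section \<open>Values of polynomials and rational functions\<close>

lemma polynomial_induct [case_names single add]:
  fixes f :: polynomial
  assumes single: "\<And>m a. P (Poly_Mapping.single m a)"
    and add: "\<And>f g. P f \<Longrightarrow> P g \<Longrightarrow> P (f + g)"
  shows "P f"
proof -
  have "P (\<Sum>m\<in>A. Poly_Mapping.single m (Poly_Mapping.lookup f m))" if "finite A" for A
    using that
  proof induction
    case empty
    show ?case using single[of 0 0] by simp
  next
    case (insert m A)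
    then show ?case by (simp add: add single)
  qed
  moreover have "(\<Sum>m\<in>Poly_Mapping.keys f. Poly_Mapping.single m (Poly_Mapping.lookup f m)) = f"
    by (rule poly_mapping_eqI)
      (simp add: lookup_sum lookup_single when_def sum.delta' in_keys_iff)
  ultimately show ?thesis by (metis finite_keys)
qed

definition monomial_value :: "(var \<Rightarrow> 'k::field) \<Rightarrow> (var \<Rightarrow>\<^sub>0 nat) \<Rightarrow> 'k" where
  "monomial_value \<rho> m = (\<Prod>v\<in>Poly_Mapping.keys m. \<rho> v ^ Poly_Mapping.lookup m v)"

lemma monomial_value_superset:
  assumes "finite A" "Poly_Mapping.keys m \<subseteq> A"
  shows "monomial_value \<rho> m = (\<Prod>v\<in>A. \<rho> v ^ Poly_Mapping.lookup m v)"
  unfolding monomial_value_def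
  by (rule prod.mono_neutral_left) (use assms in \<open>auto simp: in_keys_iff\<close>)

lemma monomial_value_add: "monomial_value \<rho> (m + n) = monomial_value \<rho> m * monomial_value \<rho> n"
proof -
  let ?A = "Poly_Mapping.keys m \<union> Poly_Mapping.keys n"
  have "finite ?A" by simp
  then show ?thesis
    using monomial_value_superset[of ?A "m + n" \<rho>] monomial_value_superset[of ?A m \<rho>]
      monomial_value_superset[of ?A n \<rho>] keys_add[of m n]
    by (simp add: lookup_add power_add prod.distrib)
qed

text \<open>
  Evaluation is developed for points with coordinates in an arbitrary field that receives the
  complex coefficients through \<open>c\<close>. Complex points give the values \<open>rf_has_value\<close> speaks of;
  points with coordinates in the field of rational functions give substitution homomorphisms, so
  the calculus of values below serves both.
\<close>
locale coefficient_map =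
  fixes c :: "complex \<Rightarrow> 'k::field"
  assumes one: "c 1 = 1" and add: "c (a + b) = c a + c b" and mult: "c (a * b) = c a * c b"
begin

lemma zero: "c 0 = 0"
  using add[of 0 0] by (simp only: add_0_left add_cancel_right_right)

definition polynomial_value :: "(var \<Rightarrow> 'k) \<Rightarrow> polynomial \<Rightarrow> 'k" where
  "polynomial_value \<rho> f =
     (\<Sum>m\<in>Poly_Mapping.keys f. c (Poly_Mapping.lookup f m) * monomial_value \<rho> m)"

lemma polynomial_value_superset:
  assumes "finite A" "Poly_Mapping.keys f \<subseteq> A"
  shows "polynomial_value \<rho> f = (\<Sum>m\<in>A. c (Poly_Mapping.lookup f m) * monomial_value \<rho> m)"
  unfolding polynomial_value_def
  by (rule sum.mono_neutral_left) (use assms in \<open>auto simp: in_keys_iff zero\<close>)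

lemma polynomial_value_single:
  "polynomial_value \<rho> (Poly_Mapping.single m a) = c a * monomial_value \<rho> m"
  by (simp add: polynomial_value_superset[of "{m}"])

lemma polynomial_value_add:
  "polynomial_value \<rho> (f + g) = polynomial_value \<rho> f + polynomial_value \<rho> g"
proof -
  let ?A = "Poly_Mapping.keys f \<union> Poly_Mapping.keys g"
  have "finite ?A" by simp
  then show ?thesis
    using polynomial_value_superset[of ?A "f + g" \<rho>] polynomial_value_superset[of ?A f \<rho>]
      polynomial_value_superset[of ?A g \<rho>] keys_add[of f g]
    by (simp add: lookup_add add sum.distrib algebra_simps)
qed

lemma polynomial_value_mult:
  "polynomial_value \<rho> (f * g) = polynomial_value \<rho> f * polynomial_value \<rho> g"
proof (induction f rule: polynomial_induct)
  case (single m a)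
  show ?case
    by (induction g rule: polynomial_induct)
      (simp_all add: mult_single polynomial_value_single polynomial_value_add monomial_value_add
        mult algebra_simps)
qed (simp add: polynomial_value_add algebra_simps)

lemma polynomial_value_0: "polynomial_value \<rho> 0 = 0"
  by (simp add: polynomial_value_def)

lemma polynomial_value_1: "polynomial_value \<rho> 1 = 1"
  using polynomial_value_single[of \<rho> 0 1] by (simp add: one monomial_value_def)

lemma polynomial_value_minus: "polynomial_value \<rho> (- f) = - polynomial_value \<rho> f"
  using polynomial_value_add[of \<rho> f "- f"] by (simp add: polynomial_value_0 eq_neg_iff_add_eq_0 add.commute)

text \<open>
  A rational function has a value at a point if it lies in the local ring of that point, the
  polynomials whose value is nonzero being inverted. The lemmas that follow say that this local
  ring is a ring and that evaluation is a well-defined homomorphism on it.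
\<close>
definition has_value :: "ratfun \<Rightarrow> (var \<Rightarrow> 'k) \<Rightarrow> 'k \<Rightarrow> bool" where
  "has_value f \<rho> k \<longleftrightarrow> (\<exists>n d. f = Fract n d \<and> polynomial_value \<rho> d \<noteq> 0 \<and>
      k = polynomial_value \<rho> n / polynomial_value \<rho> d)"

lemma has_valueI:
  "f = Fract n d \<Longrightarrow> polynomial_value \<rho> d \<noteq> 0 \<Longrightarrow>
    k = polynomial_value \<rho> n / polynomial_value \<rho> d \<Longrightarrow> has_value f \<rho> k"
  unfolding has_value_def by blast

lemma has_valueE:
  assumes "has_value f \<rho> k"
  obtains n d where "f = Fract n d" "d \<noteq> 0" "polynomial_value \<rho> d \<noteq> 0"
    "k = polynomial_value \<rho> n / polynomial_value \<rho> d"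
  using assms polynomial_value_0 unfolding has_value_def by metis

lemma has_value_unique:
  assumes "has_value f \<rho> k" "has_value f \<rho> l"
  shows "k = l"
proof -
  obtain n d where 1: "f = Fract n d" "d \<noteq> 0" "polynomial_value \<rho> d \<noteq> 0"
    "k = polynomial_value \<rho> n / polynomial_value \<rho> d" using assms(1) by (rule has_valueE)
  obtain n' d' where 2: "f = Fract n' d'" "d' \<noteq> 0" "polynomial_value \<rho> d' \<noteq> 0"
    "l = polynomial_value \<rho> n' / polynomial_value \<rho> d'" using assms(2) by (rule has_valueE)
  have "n * d' = n' * d" using 1 2 by (simp add: eq_fract)
  then have "polynomial_value \<rho> n * polynomial_value \<rho> d' = polynomial_value \<rho> n' * polynomial_value \<rho> d"
    by (metis polynomial_value_mult)
  then show ?thesis using 1 2 by (simp add: frac_eq_eq)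
qed

lemma has_value_polynomial: "has_value (Fract f 1) \<rho> (polynomial_value \<rho> f)"
  by (rule has_valueI[of _ f 1]) (simp_all add: polynomial_value_1)

lemma has_value_const: "k = c a \<Longrightarrow> has_value (rf_const a) \<rho> k"
  using has_value_polynomial[of "Poly_Mapping.single 0 a" \<rho>]
  by (simp add: rf_const_def polynomial_value_single monomial_value_def)

lemma has_value_var: "k = \<rho> v \<Longrightarrow> has_value (rf_var v) \<rho> k"
  using has_value_polynomial[of "Poly_Mapping.single (Poly_Mapping.single v 1) 1" \<rho>]
  by (simp add: rf_var_def polynomial_value_single monomial_value_def one)

lemma has_value_0: "has_value 0 \<rho> 0"
  using has_value_polynomial[of 0 \<rho>] by (simp add: polynomial_value_0 Zero_fract_def)

lemma has_value_1: "has_value 1 \<rho> 1"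
  using has_value_polynomial[of 1 \<rho>] by (simp add: polynomial_value_1 One_fract_def)

lemma has_value_add: "has_value f \<rho> k \<Longrightarrow> has_value g \<rho> l \<Longrightarrow> has_value (f + g) \<rho> (k + l)"
  by (elim has_valueE, simp, rule has_valueI[OF refl])
    (auto simp: polynomial_value_mult polynomial_value_add field_simps)

lemma has_value_minus: "has_value f \<rho> k \<Longrightarrow> has_value (- f) \<rho> (- k)"
  by (elim has_valueE, simp, rule has_valueI[OF refl]) (auto simp: polynomial_value_minus)

lemma has_value_diff: "has_value f \<rho> k \<Longrightarrow> has_value g \<rho> l \<Longrightarrow> has_value (f - g) \<rho> (k - l)"
  using has_value_add[of f \<rho> k "- g" "- l"] has_value_minus[of g \<rho> l] by simp

lemma has_value_mult: "has_value f \<rho> k \<Longrightarrow> has_value g \<rho> l \<Longrightarrow> has_value (f * g) \<rho> (k * l)"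
  by (elim has_valueE, simp, rule has_valueI[OF refl]) (auto simp: polynomial_value_mult)

lemma has_value_divide:
  "has_value f \<rho> k \<Longrightarrow> has_value g \<rho> l \<Longrightarrow> l \<noteq> 0 \<Longrightarrow> has_value (f / g) \<rho> (k / l)"
  by (elim has_valueE, simp, rule has_valueI[OF refl]) (auto simp: polynomial_value_mult)

lemma has_value_numeral: "has_value (numeral i) \<rho> (numeral i)"
  by (induction i) (simp_all only: numeral.simps has_value_1 has_value_add)

lemma has_value_power: "has_value f \<rho> k \<Longrightarrow> has_value (f ^ i) \<rho> (k ^ i)"
  by (induction i) (simp_all add: has_value_1 has_value_mult)

lemmas has_value_intros = has_value_0 has_value_1 has_value_const has_value_var has_value_add
  has_value_minus has_value_diff has_value_mult has_value_divide has_value_numeral has_value_power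

end

interpretation complex: coefficient_map "\<lambda>a. a :: complex"
  by unfold_locales simp_all

interpretation ratfun: coefficient_map rf_const
  by unfold_locales (simp_all add: rf_const_def One_fract_def single_add mult_single)

lemma rf_has_value_eq: "rf_has_value = complex.has_value"
  by (intro ext) (simp add: rf_has_value_def complex.has_value_def complex.polynomial_value_def
    monomial_value_def poly_value_def)

text \<open>
  The identity substitution as an evaluation: with it, statements about homomorphisms on polynomials
  reduce to the variables.
\<close>
lemma Fract_polynomial_eq: "ratfun.polynomial_value rf_var f = Fract f 1"
proof (induction f rule: polynomial_induct)
  case (single m a)
  have "monomial_value rf_var m = Fract (Poly_Mapping.single m 1) 1" for m
  proof -
    have pow: "rf_var v ^ k = Fract (Poly_Mapping.single (Poly_Mapping.single v k) 1) 1" for v k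
      by (induction k) (simp_all add: rf_var_def One_fract_def mult_single flip: single_add)
    have "(\<Prod>v\<in>A. rf_var v ^ Poly_Mapping.lookup m v) =
      Fract (Poly_Mapping.single (\<Sum>v\<in>A. Poly_Mapping.single v (Poly_Mapping.lookup m v)) 1) 1"
      if "finite A" for A
      using that by induction (simp_all add: pow One_fract_def mult_single)
    moreover have "(\<Sum>v\<in>Poly_Mapping.keys m. Poly_Mapping.single v (Poly_Mapping.lookup m v)) = m"
      by (rule poly_mapping_eqI)
        (simp add: lookup_sum lookup_single when_def sum.delta' in_keys_iff)
    ultimately show ?thesis by (simp add: monomial_value_def)
  qed
  then show ?case
    by (simp only: ratfun.polynomial_value_single) (simp add: rf_const_def mult_single)
qed (simp add: ratfun.polynomial_value_add)

section \<open>Substitutions as automorphisms\<close>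

locale ratfun_hom =
  fixes \<sigma> :: "ratfun \<Rightarrow> ratfun"
  assumes add: "\<sigma> (f + g) = \<sigma> f + \<sigma> g" and mult: "\<sigma> (f * g) = \<sigma> f * \<sigma> g"
    and const: "\<sigma> (rf_const a) = rf_const a"
begin

lemma zero: "\<sigma> 0 = 0"
  using add[of 0 0] by (simp only: add_0_left add_cancel_right_right)

lemma one: "\<sigma> 1 = 1"
  using const[of 1] by (simp add: ratfun.one)

lemma minus: "\<sigma> (- f) = - \<sigma> f"
  using add[of f "- f"] by (simp add: zero eq_neg_iff_add_eq_0 add.commute)

lemma diff: "\<sigma> (f - g) = \<sigma> f - \<sigma> g"
  using add[of f "- g"] by (simp add: minus)

lemma eq_0_iff: "\<sigma> f = 0 \<longleftrightarrow> f = 0"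
proof
  assume "\<sigma> f = 0"
  then have "\<sigma> (f * inverse f) = 0" by (simp add: mult)
  then show "f = 0" by (metis one right_inverse zero_neq_one)
qed (simp add: zero)

lemma divide: "\<sigma> (f / g) = \<sigma> f / \<sigma> g"
proof (cases "g = 0")
  case False
  then have "\<sigma> (f / g) * \<sigma> g = \<sigma> f" by (simp flip: mult)
  then show ?thesis using False by (simp add: eq_0_iff field_simps)
qed (simp add: zero)

lemma numeral: "\<sigma> (numeral k) = numeral k"
  by (induction k) (simp_all only: numeral.simps add one)

lemma power: "\<sigma> (f ^ k) = \<sigma> f ^ k"
  by (induction k) (simp_all add: one mult)

lemma sum: "\<sigma> (sum f A) = (\<Sum>i\<in>A. \<sigma> (f i))"
  by (induction A rule: infinite_finite_induct) (simp_all add: zero add)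

lemmas hom_simps = zero one add mult const minus diff divide numeral power eq_0_iff

lemma polynomial:
  "\<sigma> (Fract f 1) = ratfun.polynomial_value (\<lambda>v. \<sigma> (rf_var v)) f"
proof -
  have prod: "\<sigma> (prod h A) = (\<Prod>i\<in>A. \<sigma> (h i))" for h :: "var \<Rightarrow> ratfun" and A
    by (induction A rule: infinite_finite_induct) (simp_all add: one mult)
  have "\<sigma> (ratfun.polynomial_value rf_var f) = ratfun.polynomial_value (\<lambda>v. \<sigma> (rf_var v)) f"
    by (simp add: ratfun.polynomial_value_def monomial_value_def sum prod mult const power)
  then show ?thesis by (simp add: Fract_polynomial_eq)
qed

end

lemma ratfun_hom_eqI:
  assumes "ratfun_hom \<sigma>" "ratfun_hom \<tau>" and eq: "\<And>v. \<sigma> (rf_var v) = \<tau> (rf_var v)"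
  shows "\<sigma> = \<tau>"
proof
  fix f
  interpret \<sigma>: ratfun_hom \<sigma> by fact
  interpret \<tau>: ratfun_hom \<tau> by fact
  show "\<sigma> f = \<tau> f"
  proof (cases f)
    case (Fract n d)
    then have "f = Fract n 1 / Fract d 1" by simp
    then show ?thesis
      by (simp only: \<sigma>.divide \<tau>.divide \<sigma>.polynomial \<tau>.polynomial eq)
  qed
qed

lemma ratfun_hom_comp: "ratfun_hom \<sigma> \<Longrightarrow> ratfun_hom \<tau> \<Longrightarrow> ratfun_hom (\<sigma> \<circ> \<tau>)"
  by (simp add: ratfun_hom_def)

lemma ratfun_hom_id: "ratfun_hom id"
  by (simp add: ratfun_hom_def)

definition substitution :: "(var \<Rightarrow> ratfun) \<Rightarrow> ratfun \<Rightarrow> ratfun" where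
  "substitution \<rho> f = (THE g. ratfun.has_value f \<rho> g)"

lemma substitution_eq: "ratfun.has_value f \<rho> g \<Longrightarrow> substitution \<rho> f = g"
  unfolding substitution_def using ratfun.has_value_unique by blast

text \<open>
  The images of the variables define an endomorphism of the field of rational functions only if no
  nonzero polynomial is sent to \<open>0\<close>. For a substitution that squares to the identity on
  the variables this is automatic: evaluation at \<open>\<rho>\<close> is defined on the local ring of \<open>\<rho>\<close>, this ring
  contains the images of all polynomials, and evaluating the image of \<open>f\<close> returns \<open>f\<close>. Hence the
  image of \<open>f\<close> vanishes only if \<open>f\<close> does.
\<close>
locale involutive_substitution =
  fixes \<rho> :: "var \<Rightarrow> ratfun"
  assumes involutive: "ratfun.has_value (\<rho> v) \<rho> (rf_var v)"
begin

lemma has_value_polynomial_value: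
  "ratfun.has_value (ratfun.polynomial_value \<rho> f) \<rho> (Fract f 1)"
proof -
  have prod: "ratfun.has_value (\<Prod>v\<in>A. \<rho> v ^ k v) \<rho> (\<Prod>v\<in>A. rf_var v ^ k v)" for A k
    by (induction A rule: infinite_finite_induct)
      (simp_all add: ratfun.has_value_1 ratfun.has_value_mult ratfun.has_value_power involutive)
  have "ratfun.has_value (ratfun.polynomial_value \<rho> f) \<rho> (ratfun.polynomial_value rf_var f)"
    by (induction f rule: polynomial_induct)
      (auto simp: ratfun.polynomial_value_single ratfun.polynomial_value_add monomial_value_def
        intro!: ratfun.has_value_add ratfun.has_value_mult ratfun.has_value_const prod)
  then show ?thesis by (simp add: Fract_polynomial_eq)
qed

lemma polynomial_value_nonzero:
  assumes "f \<noteq> 0"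
  shows "ratfun.polynomial_value \<rho> f \<noteq> 0"
proof
  assume "ratfun.polynomial_value \<rho> f = 0"
  then have "Fract f 1 = 0"
    using has_value_polynomial_value[of f] ratfun.has_value_0 ratfun.has_value_unique by metis
  then show False using assms by (simp add: Zero_fract_def eq_fract)
qed

lemma has_value_substitution: "ratfun.has_value f \<rho> (substitution \<rho> f)"
proof (cases f)
  case (Fract n d)
  then have "ratfun.has_value f \<rho> (ratfun.polynomial_value \<rho> n / ratfun.polynomial_value \<rho> d)"
    by (auto simp: polynomial_value_nonzero intro: ratfun.has_valueI)
  then show ?thesis by (simp add: substitution_eq)
qed

sublocale ratfun_hom "substitution \<rho>"
  by unfold_locales
    (auto intro!: substitution_eq ratfun.has_value_intros has_value_substitution)

lemma substitution_var: "substitution \<rho> (rf_var v) = \<rho> v"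
  by (simp add: substitution_eq ratfun.has_value_var)

lemma substitution_comp_self: "substitution \<rho> \<circ> substitution \<rho> = id"
  by (rule ratfun_hom_eqI)
    (simp_all add: ratfun_hom_comp ratfun_hom_id ratfun_hom_axioms substitution_var
      substitution_eq involutive)

lemma substitution_field_automorphism: "field_automorphism (substitution \<rho>)"
  using o_bij[OF substitution_comp_self substitution_comp_self]
  by (simp add: field_automorphism_def add mult const)

end

section \<open>The generators\<close>

lemma (in coefficient_map) has_value_par:
  "k = (if i = 0 then \<rho> VA0 else if i = 1 then \<rho> VA1 else if i = 2 then \<rho> VA2
        else if i = 3 then \<rho> VA3 else 1 - \<rho> VA0 - \<rho> VA1 - \<rho> VA2 - \<rho> VA3) \<Longrightarrow>
    has_value (rf_par i) \<rho> k"
  unfolding rf_par_def by (auto intro!: has_value_diff has_value_var has_value_1)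

definition assignment :: "'a list \<Rightarrow> var \<Rightarrow> 'a" where
  "assignment us v = us ! var_index v"

lemma assignment_simps:
  "assignment [x,y,z,w,q,p,t,a0,a1,a2,a3] VX = x"
  "assignment [x,y,z,w,q,p,t,a0,a1,a2,a3] VY = y"
  "assignment [x,y,z,w,q,p,t,a0,a1,a2,a3] VZ = z"
  "assignment [x,y,z,w,q,p,t,a0,a1,a2,a3] VW = w"
  "assignment [x,y,z,w,q,p,t,a0,a1,a2,a3] VQ = q"
  "assignment [x,y,z,w,q,p,t,a0,a1,a2,a3] VP = p"
  "assignment [x,y,z,w,q,p,t,a0,a1,a2,a3] VT = t"
  "assignment [x,y,z,w,q,p,t,a0,a1,a2,a3] VA0 = a0"
  "assignment [x,y,z,w,q,p,t,a0,a1,a2,a3] VA1 = a1"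
  "assignment [x,y,z,w,q,p,t,a0,a1,a2,a3] VA2 = a2"
  "assignment [x,y,z,w,q,p,t,a0,a1,a2,a3] VA3 = a3"
  by (simp_all add: assignment_def)

abbreviation "X \<equiv> rf_var VX"
abbreviation "Y \<equiv> rf_var VY"
abbreviation "Z \<equiv> rf_var VZ"
abbreviation "W \<equiv> rf_var VW"
abbreviation "Q \<equiv> rf_var VQ"
abbreviation "P \<equiv> rf_var VP"
abbreviation "T \<equiv> rf_var VT"
abbreviation "\<A> \<equiv> rf_par"

text \<open>
  The lists end with the images of \<open>\<alpha>\<^sub>0, \<dots>, \<alpha>\<^sub>3\<close>; the image of \<open>\<alpha>\<^sub>4\<close> then follows, because the
  parameters sum to \<open>1\<close>.
\<close>
definition s0_images :: "var \<Rightarrow> ratfun" where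
  "s0_images = assignment [- X - 2 * \<A> 0 / Y - 1 / Y^2, - Y, - Z, - W, - Q, - P, - T,
     - \<A> 0, \<A> 1 + 2 * \<A> 0, \<A> 2, \<A> 3]"

definition s1_images :: "var \<Rightarrow> ratfun" where
  "s1_images = assignment [X, Y - \<A> 1 / (X - Z), Z, W + \<A> 1 / (X - Z), Q, P, T,
     \<A> 0 + \<A> 1, - \<A> 1, \<A> 2 + \<A> 1, \<A> 3]"

definition s2_images :: "var \<Rightarrow> ratfun" where
  "s2_images = assignment [X, Y, Z + \<A> 2 / W, W, Q, P, T,
     \<A> 0, \<A> 1 + \<A> 2, - \<A> 2, \<A> 3 + \<A> 2]"

definition s3_images :: "var \<Rightarrow> ratfun" where
  "s3_images = assignment
     [X, Y, Z, W - \<A> 3 * Q / (Z * Q - 1), Q, P - \<A> 3 * Z / (Z * Q - 1), T,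
      \<A> 0, \<A> 1, \<A> 2 + \<A> 3, - \<A> 3]"

definition s4_images :: "var \<Rightarrow> ratfun" where
  "s4_images = assignment [X, Y, Z, W, Q + 2 * \<A> 4 / P - T / P^2, P, - T,
     \<A> 0, \<A> 1, \<A> 2, \<A> 3 + 2 * \<A> 4]"

definition flip_images :: "var \<Rightarrow> ratfun" where
  "flip_images = assignment
     [- T * Q, - P / T, - T / Z, (Z * W + \<A> 2) * Z / T, - X / T, - T * Y, T,
      \<A> 4, \<A> 3, \<A> 2, \<A> 1]"

text \<open>
  Denominators are shown to be nonzero rational functions by evaluating them at one point.
\<close>
lemma has_value_nonzero: "complex.has_value f \<rho> k \<Longrightarrow> k \<noteq> 0 \<Longrightarrow> f \<noteq> 0"
  using complex.has_value_0 complex.has_value_unique by blast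

lemma rf_var_nonzero: "rf_var v \<noteq> 0"
  by (rule has_value_nonzero[OF complex.has_value_var[OF refl], of "\<lambda>_. 1"]) simp

lemma X_neq_Z: "X \<noteq> Z"
proof -
  have "X - Z \<noteq> 0"
    by (rule has_value_nonzero[OF complex.has_value_diff[OF complex.has_value_var[OF refl]
          complex.has_value_var[OF refl]], of "\<lambda>v. if v = VX then 1 else 0"]) simp
  then show ?thesis by simp
qed

lemma Z_times_Q_neq_1: "Z * Q \<noteq> 1"
proof -
  have "Z * Q - 1 \<noteq> 0"
    by (rule has_value_nonzero[OF complex.has_value_diff[OF complex.has_value_mult[OF
            complex.has_value_var[OF refl] complex.has_value_var[OF refl]] complex.has_value_1],
          of "\<lambda>v. 0"]) simp
  then show ?thesis by simp
qed

lemmas nonzero = rf_var_nonzero X_neq_Z Z_times_Q_neq_1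

lemma alpha_vars: "rf_var VA0 = \<A> 0" "rf_var VA1 = \<A> 1" "rf_var VA2 = \<A> 2" "rf_var VA3 = \<A> 3"
  and alpha_4: "\<A> 4 = 1 - \<A> 0 - \<A> 1 - \<A> 2 - \<A> 3"
  by (simp_all add: rf_par_def)

lemma (in coefficient_map) has_value_eqI: "has_value f \<rho> k \<Longrightarrow> k = l \<Longrightarrow> has_value f \<rho> l"
  by simp

lemmas ratfun_value_intros = ratfun.has_value_add ratfun.has_value_minus ratfun.has_value_diff
  ratfun.has_value_mult ratfun.has_value_divide ratfun.has_value_power
  ratfun.has_value_numeral ratfun.has_value_1
  ratfun.has_value_var[OF refl] ratfun.has_value_par[OF refl]

interpretation s0: involutive_substitution s0_images
proof
  fix v
  show "ratfun.has_value (s0_images v) s0_images (rf_var v)"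
    unfolding s0_images_def
    by (cases v; simp only: assignment_simps; rule ratfun.has_value_eqI,
        (rule ratfun_value_intros | (simp add: assignment_simps nonzero alpha_vars; fail))+;
        simp add: assignment_simps nonzero alpha_vars alpha_4 field_simps)
qed

interpretation s1: involutive_substitution s1_images
proof
  fix v
  show "ratfun.has_value (s1_images v) s1_images (rf_var v)"
    unfolding s1_images_def
    by (cases v; simp only: assignment_simps; rule ratfun.has_value_eqI,
        (rule ratfun_value_intros | (simp add: assignment_simps nonzero alpha_vars; fail))+;
        simp add: assignment_simps nonzero alpha_vars alpha_4)
qed

interpretation s2: involutive_substitution s2_images
proof
  fix v
  show "ratfun.has_value (s2_images v) s2_images (rf_var v)"
    unfolding s2_images_def
    by (cases v; simp only: assignment_simps; rule ratfun.has_value_eqI,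
        (rule ratfun_value_intros | (simp add: assignment_simps nonzero alpha_vars; fail))+;
        simp add: assignment_simps nonzero alpha_vars alpha_4)
qed

interpretation s3: involutive_substitution s3_images
proof
  fix v
  show "ratfun.has_value (s3_images v) s3_images (rf_var v)"
    unfolding s3_images_def
    by (cases v; simp only: assignment_simps; rule ratfun.has_value_eqI,
        (rule ratfun_value_intros | (simp add: assignment_simps nonzero alpha_vars; fail))+;
        simp add: assignment_simps nonzero alpha_vars alpha_4)
qed

interpretation s4: involutive_substitution s4_images
proof
  fix v
  show "ratfun.has_value (s4_images v) s4_images (rf_var v)"
    unfolding s4_images_def
    by (cases v; simp only: assignment_simps; rule ratfun.has_value_eqI,
        (rule ratfun_value_intros | (simp add: assignment_simps nonzero alpha_vars; fail))+;
        simp add: assignment_simps nonzero alpha_vars alpha_4 field_simps)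
qed

interpretation flip: involutive_substitution flip_images
proof
  fix v
  show "ratfun.has_value (flip_images v) flip_images (rf_var v)"
    unfolding flip_images_def
    by (cases v; simp only: assignment_simps; rule ratfun.has_value_eqI,
        (rule ratfun_value_intros | (simp add: assignment_simps nonzero alpha_vars; fail))+;
        simp add: assignment_simps nonzero alpha_vars alpha_4 field_simps)
qed

abbreviation "s0 \<equiv> substitution s0_images"
abbreviation "s1 \<equiv> substitution s1_images"
abbreviation "s2 \<equiv> substitution s2_images"
abbreviation "s3 \<equiv> substitution s3_images"
abbreviation "s4 \<equiv> substitution s4_images"
abbreviation "flip \<equiv> substitution flip_images"

lemma acts_by_substitution:
  assumes "involutive_substitution \<rho>"
    and "\<rho> = assignment [x, y, z, w, q, p, t, a0, a1, a2, a3]"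
    and "1 - a0 - a1 - a2 - a3 = a4"
  shows "acts_by (substitution \<rho>) [x, y, z, w, q, p, t] [a0, a1, a2, a3, a4]"
proof -
  interpret involutive_substitution \<rho> by fact
  have "\<rho> VX = x" "\<rho> VY = y" "\<rho> VZ = z" "\<rho> VW = w" "\<rho> VQ = q" "\<rho> VP = p" "\<rho> VT = t"
    "\<rho> VA0 = a0" "\<rho> VA1 = a1" "\<rho> VA2 = a2" "\<rho> VA3 = a3"
    unfolding assms(2) by (simp_all only: assignment_simps)
  then show ?thesis
    using assms(3) by (simp add: acts_by_def rf_par_def substitution_var diff one)
qed

lemma acts_s0: "acts_by s0 [- X - 2 * \<A> 0 / Y - 1 / Y^2, - Y, - Z, - W, - Q, - P, - T]
    [- \<A> 0, \<A> 1 + 2 * \<A> 0, \<A> 2, \<A> 3, \<A> 4]"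
  by (rule acts_by_substitution[OF s0.involutive_substitution_axioms s0_images_def])
    (simp add: alpha_4)

lemma acts_s1: "acts_by s1 [X, Y - \<A> 1 / (X - Z), Z, W + \<A> 1 / (X - Z), Q, P, T]
    [\<A> 0 + \<A> 1, - \<A> 1, \<A> 2 + \<A> 1, \<A> 3, \<A> 4]"
  by (rule acts_by_substitution[OF s1.involutive_substitution_axioms s1_images_def])
    (simp add: alpha_4)

lemma acts_s2: "acts_by s2 [X, Y, Z + \<A> 2 / W, W, Q, P, T]
    [\<A> 0, \<A> 1 + \<A> 2, - \<A> 2, \<A> 3 + \<A> 2, \<A> 4]"
  by (rule acts_by_substitution[OF s2.involutive_substitution_axioms s2_images_def])
    (simp add: alpha_4)

lemma acts_s3:
  "acts_by s3 [X, Y, Z, W - \<A> 3 * Q / (Z * Q - 1), Q, P - \<A> 3 * Z / (Z * Q - 1), T]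
    [\<A> 0, \<A> 1, \<A> 2 + \<A> 3, - \<A> 3, \<A> 4 + \<A> 3]"
  by (rule acts_by_substitution[OF s3.involutive_substitution_axioms s3_images_def])
    (simp add: alpha_4)

lemma acts_s4: "acts_by s4 [X, Y, Z, W, Q + 2 * \<A> 4 / P - T / P^2, P, - T]
    [\<A> 0, \<A> 1, \<A> 2, \<A> 3 + 2 * \<A> 4, - \<A> 4]"
  by (rule acts_by_substitution[OF s4.involutive_substitution_axioms s4_images_def])
    (simp add: alpha_4)

lemma acts_flip:
  "acts_by flip [- T * Q, - P / T, - T / Z, (Z * W + \<A> 2) * Z / T, - X / T, - T * Y, T]
    [\<A> 4, \<A> 3, \<A> 2, \<A> 1, \<A> 0]"
  by (rule acts_by_substitution[OF flip.involutive_substitution_axioms flip_images_def])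
    (simp add: alpha_4)

lemmas s0_simps = acts_s0[unfolded acts_by_def list.map list.inject] s0.hom_simps
lemmas s1_simps = acts_s1[unfolded acts_by_def list.map list.inject] s1.hom_simps
lemmas s2_simps = acts_s2[unfolded acts_by_def list.map list.inject] s2.hom_simps
lemmas s3_simps = acts_s3[unfolded acts_by_def list.map list.inject] s3.hom_simps
lemmas s4_simps = acts_s4[unfolded acts_by_def list.map list.inject] s4.hom_simps
lemmas flip_simps = acts_flip[unfolded acts_by_def list.map list.inject] flip.hom_simps

lemma ratfun_hom_eqI_coordinates:
  assumes "ratfun_hom \<sigma>" "ratfun_hom \<tau>"
    and "\<sigma> X = \<tau> X" "\<sigma> Y = \<tau> Y" "\<sigma> Z = \<tau> Z" "\<sigma> W = \<tau> W" "\<sigma> Q = \<tau> Q" "\<sigma> P = \<tau> P" "\<sigma> T = \<tau> T"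
    and "\<sigma> (\<A> 0) = \<tau> (\<A> 0)" "\<sigma> (\<A> 1) = \<tau> (\<A> 1)" "\<sigma> (\<A> 2) = \<tau> (\<A> 2)" "\<sigma> (\<A> 3) = \<tau> (\<A> 3)"
  shows "\<sigma> = \<tau>"
proof (rule ratfun_hom_eqI)
  show "\<sigma> (rf_var v) = \<tau> (rf_var v)" for v
    by (cases v) (simp_all only: assms alpha_vars)
qed fact+

lemmas homs = s0.ratfun_hom_axioms s1.ratfun_hom_axioms s2.ratfun_hom_axioms
  s3.ratfun_hom_axioms s4.ratfun_hom_axioms flip.ratfun_hom_axioms ratfun_hom_comp

section \<open>Relations between the generators\<close>

lemma s0_s2_commute: "s0 \<circ> s2 = s2 \<circ> s0"
  by (rule ratfun_hom_eqI_coordinates; (intro homs)?) (simp_all add: s0_simps s2_simps del: One_nat_def)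

lemma s0_s3_commute: "s0 \<circ> s3 = s3 \<circ> s0"
  by (rule ratfun_hom_eqI_coordinates; (intro homs)?) (simp_all add: s0_simps s3_simps del: One_nat_def)

lemma s0_s4_commute: "s0 \<circ> s4 = s4 \<circ> s0"
  by (rule ratfun_hom_eqI_coordinates; (intro homs)?) (simp_all add: s0_simps s4_simps del: One_nat_def)

lemma s1_s3_commute: "s1 \<circ> s3 = s3 \<circ> s1"
  by (rule ratfun_hom_eqI_coordinates; (intro homs)?) (simp_all add: s1_simps s3_simps del: One_nat_def)

text \<open>
  Put \<open>g = x - z\<close> and \<open>h = g w\<close>. Then \<open>s\<^sub>1\<close> fixes \<open>g\<close> and sends \<open>h\<close> to \<open>h + \<alpha>\<^sub>1\<close>, while \<open>s\<^sub>2\<close> fixes \<open>w\<close>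
  and sends \<open>h\<close> to \<open>h - \<alpha>\<^sub>2\<close>; so on \<open>g\<close>, \<open>w\<close> and \<open>h\<close> only shifts of \<open>h\<close> have to be followed.
  The remaining coordinates come from the common invariants \<open>x\<close> and \<open>y + w\<close>.
\<close>
lemma s1_s2_braid: "s1 \<circ> s2 \<circ> s1 = s2 \<circ> s1 \<circ> s2"
proof -
  define g h where "g = X - Z" and "h = g * W"
  have nz: "g \<noteq> 0" "W \<noteq> 0"
    by (simp_all add: g_def nonzero)
  have s1g: "s1 g = g" and s1w: "s1 W = (h + \<A> 1) / g" and s1yw: "s1 (Y + W) = Y + W"
    using nz by (simp_all add: h_def add_divide_distrib) (simp_all add: g_def s1_simps)
  have s1h: "s1 h = h + \<A> 1"
    using nz by (simp add: h_def s1.mult s1g s1w)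
  note 1 = s1g s1w s1yw s1h
  have 2: "s2 g = (h - \<A> 2) / W" "s2 h = h - \<A> 2" "s2 W = W" "s2 (Y + W) = Y + W"
    using nz by (simp_all add: g_def h_def s2_simps field_simps del: One_nat_def)
  have par: "s1 (\<A> 0) = \<A> 0 + \<A> 1" "s1 (\<A> 1) = - \<A> 1" "s1 (\<A> 2) = \<A> 2 + \<A> 1" "s1 (\<A> 3) = \<A> 3"
    "s2 (\<A> 0) = \<A> 0" "s2 (\<A> 1) = \<A> 1 + \<A> 2" "s2 (\<A> 2) = - \<A> 2" "s2 (\<A> 3) = \<A> 3 + \<A> 2"
    by (simp_all only: s1_simps s2_simps)
  have "s1 h \<noteq> 0" "s2 h \<noteq> 0"
    using nz by (simp_all only: s1.eq_0_iff s2.eq_0_iff h_def) simp_all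
  then have nz': "h + \<A> 1 \<noteq> 0" "h - \<A> 2 \<noteq> 0" by (simp_all add: 1 2)
  have g: "(s1 \<circ> s2 \<circ> s1) g = (s2 \<circ> s1 \<circ> s2) g"
    using nz nz' by (simp add: 1 2 par s1.hom_simps s2.hom_simps del: One_nat_def) (simp add: h_def)
  have w: "(s1 \<circ> s2 \<circ> s1) W = (s2 \<circ> s1 \<circ> s2) W"
    using nz nz' by (simp add: 1 2 par s1.hom_simps s2.hom_simps del: One_nat_def) (simp add: h_def)
  have x: "(s1 \<circ> s2 \<circ> s1) X = (s2 \<circ> s1 \<circ> s2) X"
    by (simp add: s1_simps s2_simps)
  have yw: "(s1 \<circ> s2 \<circ> s1) (Y + W) = (s2 \<circ> s1 \<circ> s2) (Y + W)"
    by (simp add: 1 2)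
  interpret L: ratfun_hom "s1 \<circ> s2 \<circ> s1" by (intro homs)
  interpret R: ratfun_hom "s2 \<circ> s1 \<circ> s2" by (intro homs)
  show ?thesis
  proof (rule ratfun_hom_eqI_coordinates)
    show "(s1 \<circ> s2 \<circ> s1) Y = (s2 \<circ> s1 \<circ> s2) Y"
      using yw w by (simp only: L.add R.add) simp
    show "(s1 \<circ> s2 \<circ> s1) Z = (s2 \<circ> s1 \<circ> s2) Z"
      using g x by (simp only: g_def L.diff R.diff) simp
  qed (use x w in \<open>simp_all add: s1_simps s2_simps L.ratfun_hom_axioms R.ratfun_hom_axioms del: One_nat_def\<close>)
qed

text \<open>
  Iterating the two reflections produces large rational functions of \<open>g = x - z\<close>, \<open>y\<close> and the
  parameters. With \<open>m\<close>, \<open>N\<close>, \<open>n\<close>, \<open>K\<close> as in the proof, all of them are monomials, because the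
  reflections send each of the six elements to a monomial in the six:
  \<open>s\<^sub>1: g \<mapsto> g, y \<mapsto> m/g, m \<mapsto> g y, N \<mapsto> K/g, n \<mapsto> n, K \<mapsto> g N\<close> and
  \<open>s\<^sub>0: g \<mapsto> - N/y\<^sup>2, y \<mapsto> - y, m \<mapsto> n/y, N \<mapsto> - g y\<^sup>2, n \<mapsto> - y m, K \<mapsto> K\<close>.
  Both sides of the relation send \<open>y\<close> to \<open>m n/K\<close> and \<open>g\<close> to \<open>N K/n\<^sup>2\<close>. The coordinate \<open>w\<close> follows
  because \<open>y + w\<close> is fixed by \<open>s\<^sub>1\<close> and negated by \<open>s\<^sub>0\<close>.
\<close>
lemma s0_s1_braid: "s0 \<circ> s1 \<circ> s0 \<circ> s1 = s1 \<circ> s0 \<circ> s1 \<circ> s0"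
proof -
  define \<beta> g m N n K where "\<beta> = \<A> 1 + 2 * \<A> 0" and "g = X - Z" and "m = g * Y - \<A> 1"
    and "N = g * Y^2 + 2 * \<A> 0 * Y + 1" and "n = N - \<beta> * Y" and "K = g * N - \<A> 1 * \<beta>"
  note defs = \<beta>_def g_def m_def N_def n_def K_def
  have nz: "g \<noteq> 0" "Y \<noteq> 0"
    by (simp_all add: g_def nonzero)
  have par: "s1 (\<A> 0) = \<A> 0 + \<A> 1" "s1 (\<A> 1) = - \<A> 1" "s1 \<beta> = \<beta>"
    "s0 (\<A> 0) = - \<A> 0" "s0 (\<A> 1) = \<beta>" "s0 \<beta> = \<A> 1"
    by (simp_all add: \<beta>_def s0_simps s1_simps del: One_nat_def)
  have s1g: "s1 g = g" and s1y: "s1 Y = m / g"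
    using nz by (simp_all add: g_def m_def s1_simps field_simps del: One_nat_def)
  have s1m: "s1 m = g * Y"
    using nz by (simp add: m_def s1.hom_simps par s1g s1y del: One_nat_def)
  have s1N: "s1 N = K / g"
    using nz by (simp add: N_def s1.hom_simps par s1g s1y del: One_nat_def)
      (simp add: K_def N_def m_def \<beta>_def field_simps power2_eq_square)
  have s1n: "s1 n = n"
    using nz by (simp add: n_def s1.hom_simps par s1y s1N del: One_nat_def)
      (simp add: K_def m_def field_simps)
  have s1K: "s1 K = g * N"
    using nz by (simp add: K_def s1.hom_simps par s1g s1N del: One_nat_def)
  note 1 = s1g s1y s1m s1N s1n s1K
  have s0y: "s0 Y = - Y" and s0g: "s0 g = - N / Y^2"
    using nz by (simp_all add: g_def N_def s0_simps field_simps power2_eq_square)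
  have s0N: "s0 N = - g * Y^2"
    using nz by (simp add: N_def s0.hom_simps par s0g s0y del: One_nat_def)
  have s0m: "s0 m = n / Y"
    using nz by (simp add: m_def s0.hom_simps par s0g s0y del: One_nat_def)
      (simp add: n_def field_simps power2_eq_square)
  have s0n: "s0 n = - Y * m"
    using nz by (simp add: n_def s0.hom_simps par s0N s0y del: One_nat_def)
      (simp add: m_def field_simps power2_eq_square)
  have s0K: "s0 K = K"
    using nz by (simp add: K_def s0.hom_simps par s0g s0N del: One_nat_def)
  note 0 = s0g s0y s0m s0N s0n s0K
  have "s1 Y \<noteq> 0" "s0 g \<noteq> 0"
    using nz by (simp_all add: s0.eq_0_iff s1.eq_0_iff)
  then have nz2: "m \<noteq> 0" "N \<noteq> 0" by (auto simp: s1y s0g)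
  then have "s1 N \<noteq> 0" "s0 m \<noteq> 0"
    by (simp_all add: s0.eq_0_iff s1.eq_0_iff)
  then have nz3: "n \<noteq> 0" "K \<noteq> 0" by (auto simp: s1N s0m)
  let ?L = "s0 \<circ> s1 \<circ> s0 \<circ> s1" and ?R = "s1 \<circ> s0 \<circ> s1 \<circ> s0"
  have y: "?L Y = ?R Y"
    using nz nz2 nz3 by (simp add: 0 1 s0.hom_simps s1.hom_simps power2_eq_square del: One_nat_def)
  have g: "?L g = ?R g"
    using nz nz2 nz3 by (simp add: 0 1 s0.hom_simps s1.hom_simps power2_eq_square del: One_nat_def)
  have z: "?L Z = ?R Z"
    by (simp add: s0_simps s1_simps)
  have "s1 (Y + W) = Y + W" "s0 (Y + W) = - (Y + W)"
    by (simp_all add: s0_simps s1_simps)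
  then have yw: "?L (Y + W) = ?R (Y + W)"
    by (simp only: comp_apply s0.minus s1.minus)
  interpret L: ratfun_hom ?L by (intro homs)
  interpret R: ratfun_hom ?R by (intro homs)
  show ?thesis
  proof (rule ratfun_hom_eqI_coordinates)
    show "?L W = ?R W"
      using yw y by (simp only: L.add R.add) simp
    show "?L X = ?R X"
      using g z by (simp only: g_def L.diff R.diff) simp
  qed (use y z in \<open>simp_all add: s0_simps s1_simps L.ratfun_hom_axioms R.ratfun_hom_axioms del: One_nat_def\<close>)
qed

lemma flip_s0: "flip \<circ> s0 = s4 \<circ> flip"
  by (rule ratfun_hom_eqI_coordinates; (intro homs)?)
    (simp_all add: s0_simps s4_simps flip_simps nonzero field_simps power2_eq_square del: One_nat_def)

lemma flip_s1: "flip \<circ> s1 = s3 \<circ> flip"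
proof -
  define D where "D = Z * Q - 1"
  have D_nonzero: "D \<noteq> 0"
    by (simp add: D_def nonzero)
  have "Z * (\<A> 3 * Q) / D = \<A> 3 * (D + 1) / D"
    by (simp add: D_def)
  then have D: "Z * (\<A> 3 * Q) / D = \<A> 3 + \<A> 3 / D"
    using D_nonzero by (simp add: field_simps)
  have "T / Z - T * Q = - (D * T / Z)"
    by (simp add: D_def nonzero field_simps)
  then have *: "\<A> 3 / (T / Z - T * Q) = - (\<A> 3 / D * Z / T)"
    by (simp add: nonzero)
  have y: "(flip \<circ> s1) Y = (s3 \<circ> flip) Y"
    by (simp add: s1_simps s3_simps flip_simps * D_def[symmetric] diff_divide_distrib del: One_nat_def)
  have "(flip \<circ> s1) W = (Z * W + \<A> 2 - \<A> 3 / D) * Z / T"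
    by (simp add: s1_simps flip_simps * diff_divide_distrib left_diff_distrib del: One_nat_def)
  also have "\<dots> = (s3 \<circ> flip) W"
    by (simp add: s3_simps flip_simps D D_def[symmetric] right_diff_distrib)
  finally have w: "(flip \<circ> s1) W = (s3 \<circ> flip) W" .
  show ?thesis
    by (rule ratfun_hom_eqI_coordinates[OF ratfun_hom_comp ratfun_hom_comp _ y _ w])
      (simp_all add: homs s1_simps s3_simps flip_simps del: One_nat_def)
qed

lemma flip_s2: "flip \<circ> s2 = s2 \<circ> flip"
proof -
  have "s2 Z \<noteq> 0" by (simp only: s2.eq_0_iff) (rule nonzero)
  then have "Z * W + \<A> 2 \<noteq> 0" by (simp add: s2_simps nonzero field_simps)
  then have "\<A> 2 + W * Z \<noteq> 0" by (simp add: algebra_simps)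
  moreover from this have "Z * (\<A> 2 + W * Z) \<noteq> 0" by (simp add: nonzero)
  then have "Z * \<A> 2 + W * (Z * Z) \<noteq> 0" by (simp only: distrib_left ac_simps not_False_eq_True)
  ultimately show ?thesis
    by (intro ratfun_hom_eqI_coordinates homs)
      (simp_all add: s2_simps flip_simps nonzero field_simps del: One_nat_def)
qed

text \<open>The Coxeter relations follow from their braid forms.\<close>
lemma involutions_power_4:
  assumes "A \<circ> A = id" "B \<circ> B = id" "A \<circ> B \<circ> A \<circ> B = B \<circ> A \<circ> B \<circ> A"
  shows "(A \<circ> B) ^^ 4 = id"
proof
  fix f
  have "A (A g) = g" "B (B g) = g" "A (B (A (B g))) = B (A (B (A g)))" for g
    using assms by (simp_all add: fun_eq_iff)
  then have "A (B (A (B (A (B (A (B f))))))) = f" by metis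
  then show "((A \<circ> B) ^^ 4) f = id f"
    by (simp add: eval_nat_numeral)
qed

lemma involutions_power_3:
  assumes "A \<circ> A = id" "B \<circ> B = id" "A \<circ> B \<circ> A = B \<circ> A \<circ> B"
  shows "(A \<circ> B) ^^ 3 = id"
proof
  fix f
  have "A (A g) = g" "B (B g) = g" "A (B (A g)) = B (A (B g))" for g
    using assms by (simp_all add: fun_eq_iff)
  then have "A (B (A (B (A (B f))))) = f" by metis
  then show "((A \<circ> B) ^^ 3) f = id f"
    by (simp add: eval_nat_numeral)
qed

lemma involutions_power_2:
  assumes "A \<circ> A = id" "B \<circ> B = id" "A \<circ> B = B \<circ> A"
  shows "(A \<circ> B) ^^ 2 = id"
proof
  fix f
  have "A (A g) = g" "B (B g) = g" "A (B g) = B (A g)" for g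
    using assms by (simp_all add: fun_eq_iff)
  then have "A (B (A (B f))) = f" by metis
  then show "((A \<circ> B) ^^ 2) f = id f"
    by (simp add: eval_nat_numeral)
qed

lemmas involutions = s0.substitution_comp_self s1.substitution_comp_self s2.substitution_comp_self
  s3.substitution_comp_self s4.substitution_comp_self flip.substitution_comp_self

text \<open>
  Conjugation by \<open>flip\<close> reverses the diagram, so every relation among \<open>s\<^sub>0, s\<^sub>1, s\<^sub>2\<close> has a mirror image
  among \<open>s\<^sub>4, s\<^sub>3, s\<^sub>2\<close>.
\<close>

lemma conjugates:
  "flip (flip f) = f" "flip (s0 (flip f)) = s4 f" "flip (s1 (flip f)) = s3 f"
  "flip (s2 (flip f)) = s2 f" "flip (s3 (flip f)) = s1 f" "flip (s4 (flip f)) = s0 f"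
proof -
  have flip: "flip (flip g) = g" for g
    using involutions(6) by (simp add: fun_eq_iff)
  have "flip (s0 g) = s4 (flip g)" "flip (s1 g) = s3 (flip g)" "flip (s2 g) = s2 (flip g)" for g
    using flip_s0 flip_s1 flip_s2 by (simp_all add: fun_eq_iff)
  then show "flip (flip f) = f" "flip (s0 (flip f)) = s4 f" "flip (s1 (flip f)) = s3 f"
    "flip (s2 (flip f)) = s2 f" "flip (s3 (flip f)) = s1 f" "flip (s4 (flip f)) = s0 f"
    by (metis flip)+
qed

lemma s3_s4_braid: "s3 \<circ> s4 \<circ> s3 \<circ> s4 = s4 \<circ> s3 \<circ> s4 \<circ> s3"
proof
  fix f
  have "flip (s1 (s0 (s1 (s0 (flip f))))) = flip (s0 (s1 (s0 (s1 (flip f)))))"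
    using s0_s1_braid by (simp add: fun_eq_iff)
  then show "(s3 \<circ> s4 \<circ> s3 \<circ> s4) f = (s4 \<circ> s3 \<circ> s4 \<circ> s3) f"
    unfolding comp_apply by (metis conjugates)
qed

lemma s2_s3_braid: "s2 \<circ> s3 \<circ> s2 = s3 \<circ> s2 \<circ> s3"
proof
  fix f
  have "flip (s1 (s2 (s1 (flip f)))) = flip (s2 (s1 (s2 (flip f))))"
    using s1_s2_braid by (simp add: fun_eq_iff)
  then show "(s2 \<circ> s3 \<circ> s2) f = (s3 \<circ> s2 \<circ> s3) f"
    unfolding comp_apply by (metis conjugates)
qed

lemma s2_s4_commute: "s2 \<circ> s4 = s4 \<circ> s2"
proof
  fix f
  have "flip (s0 (s2 (flip f))) = flip (s2 (s0 (flip f)))"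
    using s0_s2_commute by (simp add: fun_eq_iff)
  then show "(s2 \<circ> s4) f = (s4 \<circ> s2) f"
    unfolding comp_apply by (metis conjugates)
qed

lemma s1_s4_commute: "s1 \<circ> s4 = s4 \<circ> s1"
proof
  fix f
  have "flip (s0 (s3 (flip f))) = flip (s3 (s0 (flip f)))"
    using s0_s3_commute by (simp add: fun_eq_iff)
  then show "(s1 \<circ> s4) f = (s4 \<circ> s1) f"
    unfolding comp_apply by (metis conjugates)
qed

section \<open>The vector field\<close>
definition velocity_x :: "(nat \<Rightarrow> complex) \<Rightarrow>
    complex \<Rightarrow> complex \<Rightarrow> complex \<Rightarrow> complex \<Rightarrow> complex \<Rightarrow> complex \<Rightarrow> complex \<Rightarrow> complex"
  where
  "velocity_x a t x y z w q p = (x^2 * y + a 0 * x + z * (z * w + a 2) - p) / t"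
definition velocity_y :: "(nat \<Rightarrow> complex) \<Rightarrow>
    complex \<Rightarrow> complex \<Rightarrow> complex \<Rightarrow> complex \<Rightarrow> complex \<Rightarrow> complex \<Rightarrow> complex \<Rightarrow> complex"
  where
  "velocity_y a t x y z w q p = - (2 * x * y^2 + 2 * a 0 * y + 1) / (2 * t)"
definition velocity_z :: "(nat \<Rightarrow> complex) \<Rightarrow>
    complex \<Rightarrow> complex \<Rightarrow> complex \<Rightarrow> complex \<Rightarrow> complex \<Rightarrow> complex \<Rightarrow> complex \<Rightarrow> complex"
  where
  "velocity_z a t x y z w q p = (z^2 * w + (a 0 + a 1 + a 2) * z + y * z^2 - p) / t"
definition velocity_w :: "(nat \<Rightarrow> complex) \<Rightarrow>
    complex \<Rightarrow> complex \<Rightarrow> complex \<Rightarrow> complex \<Rightarrow> complex \<Rightarrow> complex \<Rightarrow> complex \<Rightarrow> complex"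
  where
  "velocity_w a t x y z w q p = - (z * w^2 + (a 0 + a 1 + a 2) * w + 2 * y * z * w + a 2 * y) / t"
definition velocity_q :: "(nat \<Rightarrow> complex) \<Rightarrow>
    complex \<Rightarrow> complex \<Rightarrow> complex \<Rightarrow> complex \<Rightarrow> complex \<Rightarrow> complex \<Rightarrow> complex \<Rightarrow> complex"
  where
  "velocity_q a t x y z w q p = (q^2 * p + (a 4 - 1) * q - y - w) / t"
definition velocity_p :: "(nat \<Rightarrow> complex) \<Rightarrow>
    complex \<Rightarrow> complex \<Rightarrow> complex \<Rightarrow> complex \<Rightarrow> complex \<Rightarrow> complex \<Rightarrow> complex \<Rightarrow> complex"
  where
  "velocity_p a t x y z w q p = - (2 * q * p^2 + 2 * (a 4 - 1) * p - t) / (2 * t)"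

lemmas velocity_defs = velocity_x_def velocity_y_def velocity_z_def velocity_w_def
  velocity_q_def velocity_p_def

lemma hamiltonian_derivs:
  assumes "t \<noteq> 0"
  shows "deriv (\<lambda>v. hamiltonian a t x v z w q p) y = velocity_x a t x y z w q p"
    and "- deriv (\<lambda>v. hamiltonian a t v y z w q p) x = velocity_y a t x y z w q p"
    and "deriv (\<lambda>v. hamiltonian a t x y z v q p) w = velocity_z a t x y z w q p"
    and "- deriv (\<lambda>v. hamiltonian a t x y v w q p) z = velocity_w a t x y z w q p"
    and "deriv (\<lambda>v. hamiltonian a t x y z w q v) p = velocity_q a t x y z w q p"
    and "- deriv (\<lambda>v. hamiltonian a t x y z w v p) q = velocity_p a t x y z w q p"
proof -
  show "deriv (\<lambda>v. hamiltonian a t x v z w q p) y = velocity_x a t x y z w q p"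
    unfolding hamiltonian_def velocity_defs using assms
    by (intro DERIV_imp_deriv) (rule derivative_eq_intros refl | simp add: field_simps power2_eq_square)+
  have "deriv (\<lambda>v. hamiltonian a t v y z w q p) x = - velocity_y a t x y z w q p"
    unfolding hamiltonian_def velocity_defs using assms
    by (intro DERIV_imp_deriv) (rule derivative_eq_intros refl | simp add: field_simps power2_eq_square)+
  then show "- deriv (\<lambda>v. hamiltonian a t v y z w q p) x = velocity_y a t x y z w q p" by simp
  show "deriv (\<lambda>v. hamiltonian a t x y z v q p) w = velocity_z a t x y z w q p"
    unfolding hamiltonian_def velocity_defs using assms
    by (intro DERIV_imp_deriv) (rule derivative_eq_intros refl | simp add: field_simps power2_eq_square)+
  have "deriv (\<lambda>v. hamiltonian a t x y v w q p) z = - velocity_w a t x y z w q p"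
    unfolding hamiltonian_def velocity_defs using assms
    by (intro DERIV_imp_deriv) (rule derivative_eq_intros refl | simp add: field_simps power2_eq_square)+
  then show "- deriv (\<lambda>v. hamiltonian a t x y v w q p) z = velocity_w a t x y z w q p" by simp
  show "deriv (\<lambda>v. hamiltonian a t x y z w q v) p = velocity_q a t x y z w q p"
    unfolding hamiltonian_def velocity_defs using assms
    by (intro DERIV_imp_deriv) (rule derivative_eq_intros refl | simp add: field_simps power2_eq_square)+
  have "deriv (\<lambda>v. hamiltonian a t x y z w v p) q = - velocity_p a t x y z w q p"
    unfolding hamiltonian_def velocity_defs using assms
    by (intro DERIV_imp_deriv) (rule derivative_eq_intros refl | simp add: field_simps power2_eq_square)+
  then show "- deriv (\<lambda>v. hamiltonian a t x y z w v p) q = velocity_p a t x y z w q p" by simp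
qed

lemma solves_iff:
  "solves a S x y z w q p \<longleftrightarrow>
     (\<Sum>i\<le>4. a i) = 1 \<and> open S \<and> S \<noteq> {} \<and> 0 \<notin> S \<and>
     (\<forall>t\<in>S.
        (x has_field_derivative velocity_x a t (x t) (y t) (z t) (w t) (q t) (p t)) (at t) \<and>
        (y has_field_derivative velocity_y a t (x t) (y t) (z t) (w t) (q t) (p t)) (at t) \<and>
        (z has_field_derivative velocity_z a t (x t) (y t) (z t) (w t) (q t) (p t)) (at t) \<and>
        (w has_field_derivative velocity_w a t (x t) (y t) (z t) (w t) (q t) (p t)) (at t) \<and>
        (q has_field_derivative velocity_q a t (x t) (y t) (z t) (w t) (q t) (p t)) (at t) \<and>
        (p has_field_derivative velocity_p a t (x t) (y t) (z t) (w t) (q t) (p t)) (at t))"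
proof -
  have *: "t \<noteq> 0" if "t \<in> S" "0 \<notin> S" for t
    using that by auto
  show ?thesis
    unfolding solves_def by (auto simp: hamiltonian_derivs *)
qed

text \<open>
  Since \<open>\<epsilon>\<close> is its own inverse, a function of the new time \<open>\<epsilon> t\<close> is recovered from its expression in
  the old time by another multiplication with \<open>\<epsilon>\<close>.
\<close>
lemma derivative_of_image:
  fixes S :: "complex set"
  assumes "open S" "t \<in> S" "\<And>s. s \<in> S \<Longrightarrow> x' (\<epsilon> * s) = F s" "\<epsilon> = 1 \<or> \<epsilon> = -1"
    and "(F has_field_derivative \<epsilon> * D) (at t)"
  shows "(x' has_field_derivative D) (at (\<epsilon> * t))"
proof -
  have \<epsilon>: "\<epsilon> * (\<epsilon> * s) = s" for s
    using assms(4) by auto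
  have "((\<lambda>s. F (\<epsilon> * s)) has_field_derivative (\<epsilon> * D) * \<epsilon>) (at (\<epsilon> * t))"
    by (rule DERIV_chain2[of F]) (auto simp: \<epsilon> assms(5) intro!: derivative_eq_intros)
  then have "((\<lambda>s. F (\<epsilon> * s)) has_field_derivative D) (at (\<epsilon> * t))"
    using assms(4) by auto
  moreover have "open ((\<lambda>s. \<epsilon> * s) -` S)"
    by (intro open_vimage assms(1) continuous_intros)
  moreover have "F (\<epsilon> * s) = x' s" if "s \<in> (\<lambda>s. \<epsilon> * s) -` S" for s
    using assms(3)[of "\<epsilon> * s"] that by (simp add: \<epsilon>)
  ultimately show ?thesis
    using assms(2) by (elim has_field_derivative_transform_within_open) (auto simp: \<epsilon>)
qed

lemma solves_image:
  assumes "solves a S x y z w q p" and "(\<Sum>i\<le>4. a' i) = 1" and \<epsilon>: "\<epsilon> = 1 \<or> \<epsilon> = -1"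
    and im: "\<And>t. t \<in> S \<Longrightarrow> x' (\<epsilon> * t) = F t" "\<And>t. t \<in> S \<Longrightarrow> y' (\<epsilon> * t) = G t"
      "\<And>t. t \<in> S \<Longrightarrow> z' (\<epsilon> * t) = H t" "\<And>t. t \<in> S \<Longrightarrow> w' (\<epsilon> * t) = K t"
      "\<And>t. t \<in> S \<Longrightarrow> q' (\<epsilon> * t) = L t" "\<And>t. t \<in> S \<Longrightarrow> p' (\<epsilon> * t) = M t"
    and der: "\<And>t. t \<in> S \<Longrightarrow> (F has_field_derivative
          \<epsilon> * velocity_x a' (\<epsilon> * t) (F t) (G t) (H t) (K t) (L t) (M t)) (at t)"
      "\<And>t. t \<in> S \<Longrightarrow> (G has_field_derivative
          \<epsilon> * velocity_y a' (\<epsilon> * t) (F t) (G t) (H t) (K t) (L t) (M t)) (at t)"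
      "\<And>t. t \<in> S \<Longrightarrow> (H has_field_derivative
          \<epsilon> * velocity_z a' (\<epsilon> * t) (F t) (G t) (H t) (K t) (L t) (M t)) (at t)"
      "\<And>t. t \<in> S \<Longrightarrow> (K has_field_derivative
          \<epsilon> * velocity_w a' (\<epsilon> * t) (F t) (G t) (H t) (K t) (L t) (M t)) (at t)"
      "\<And>t. t \<in> S \<Longrightarrow> (L has_field_derivative
          \<epsilon> * velocity_q a' (\<epsilon> * t) (F t) (G t) (H t) (K t) (L t) (M t)) (at t)"
      "\<And>t. t \<in> S \<Longrightarrow> (M has_field_derivative
          \<epsilon> * velocity_p a' (\<epsilon> * t) (F t) (G t) (H t) (K t) (L t) (M t)) (at t)"
  shows "solves a' ((\<lambda>t. \<epsilon> * t) ` S) x' y' z' w' q' p'"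
proof -
  have S: "open S" "S \<noteq> {}" "0 \<notin> S" using assms(1) by (simp_all add: solves_def)
  have "(\<lambda>t. \<epsilon> * t) ` S = (\<lambda>t. \<epsilon> * t) -` S"
    using \<epsilon> by (force simp: image_iff)
  then have "open ((\<lambda>t. \<epsilon> * t) ` S)"
    using S by (auto intro!: open_vimage continuous_intros)
  moreover have "0 \<notin> (\<lambda>t. \<epsilon> * t) ` S" using S \<epsilon> by auto
  moreover note derivs = derivative_of_image[OF S(1) _ im(1) \<epsilon> der(1)]
    derivative_of_image[OF S(1) _ im(2) \<epsilon> der(2)] derivative_of_image[OF S(1) _ im(3) \<epsilon> der(3)]
    derivative_of_image[OF S(1) _ im(4) \<epsilon> der(4)] derivative_of_image[OF S(1) _ im(5) \<epsilon> der(5)]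
    derivative_of_image[OF S(1) _ im(6) \<epsilon> der(6)]
  ultimately show ?thesis
    unfolding solves_iff using S assms(2) by (simp add: im derivs)
qed

section \<open>Poles of the transformed coordinates\<close>

text \<open>
  A fraction \<open>h / g\<close> may have a value at a common zero of \<open>g\<close> and \<open>h\<close> if it can be reduced. To exclude
  this, the point is moved along the variable \<open>u\<close>, on a line where \<open>g\<close> stays zero and \<open>h\<close> does not.
  A denominator \<open>d\<close> that is nonzero at the point stays so nearby, where the value of \<open>(h / g) g\<close>
  would have to be both zero and nonzero. Moving a parameter is what makes this work for
  \<open>\<alpha>\<^sub>1 / (x - z)\<close> when the given solution has \<open>\<alpha>\<^sub>1 = 0\<close>: the rational function still has
  a pole there, and the solution must avoid it.
\<close>
lemma no_value_at_pole:
  assumes "complex.has_value f \<rho> k" "f * g = h"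
    and "\<And>e. complex.has_value g (\<rho>(u := \<rho> u + e)) 0"
    and "\<And>e. complex.has_value h (\<rho>(u := \<rho> u + e)) (l e)" and "\<forall>\<^sub>F e in at 0. l e \<noteq> 0"
  shows False
proof -
  obtain n d where f: "f = Fract n d" and d: "complex.polynomial_value \<rho> d \<noteq> 0"
    using assms(1) by (rule complex.has_valueE)
  let ?D = "\<lambda>e. complex.polynomial_value (\<rho>(u := \<rho> u + e)) d"
  have "isCont (\<lambda>e. (\<rho>(u := \<rho> u + e)) v) 0" for v
    by (cases "v = u") (auto intro!: continuous_intros)
  then have "isCont ?D 0"
    unfolding complex.polynomial_value_def monomial_value_def by (intro continuous_intros)
  then have "\<forall>\<^sub>F e in at 0. ?D e \<noteq> 0"
    using d by (auto simp: isCont_def dest!: tendsto_imp_eventually_ne)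
  with assms(5) have "\<forall>\<^sub>F e in at 0. ?D e \<noteq> 0 \<and> l e \<noteq> 0"
    by eventually_elim simp
  then obtain e where e: "?D e \<noteq> 0" "l e \<noteq> 0"
    using eventually_happens by fastforce
  have "complex.has_value f (\<rho>(u := \<rho> u + e)) (complex.polynomial_value (\<rho>(u := \<rho> u + e)) n / ?D e)"
    by (rule complex.has_valueI[OF f e(1) refl])
  then have "complex.has_value h (\<rho>(u := \<rho> u + e)) 0"
    using complex.has_value_mult[OF _ assms(3)] assms(2) by force
  then show False
    using e(2) assms(4) complex.has_value_unique by blast
qed

section \<open>Reduction of the Baecklund property\<close>

lemma point_values:
  "complex.has_value X (point x y z w q p t a) x"
  "complex.has_value Y (point x y z w q p t a) y"
  "complex.has_value Z (point x y z w q p t a) z"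
  "complex.has_value W (point x y z w q p t a) w"
  "complex.has_value Q (point x y z w q p t a) q"
  "complex.has_value P (point x y z w q p t a) p"
  "complex.has_value T (point x y z w q p t a) t"
  by (auto intro!: complex.has_value_var)

lemma point_value_par:
  assumes "(\<Sum>i\<le>4. a i) = 1" "i \<le> 4"
  shows "complex.has_value (rf_par i) (point x y z w q p t a) (a i)"
proof -
  have "a 4 = 1 - a 0 - a 1 - a 2 - a 3"
    using assms(1) by (simp add: eval_nat_numeral algebra_simps)
  moreover have "i = 0 \<or> i = 1 \<or> i = 2 \<or> i = 3 \<or> i = 4"
    using assms(2) by linarith
  ultimately show ?thesis
    by (auto intro!: complex.has_value_par)
qed

text \<open>
  The new time \<open>\<tau>\<close> is pinned down to \<open>\<epsilon> t\<close> because it is the value of \<open>\<sigma>(t)\<close>; only the images of the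
  coordinates and of the parameters remain to be treated for each generator.
\<close>
lemma baecklund_transformationI:
  assumes "field_automorphism \<sigma>" "affine_on_parameters \<sigma>" and \<epsilon>: "\<epsilon> = 1 \<or> \<epsilon> = -1"
    and T: "\<sigma> T = rf_const \<epsilon> * T"
    and image: "\<And>a S x y z w q p a' x' y' z' w' q' p'. solves a S x y z w q p \<Longrightarrow>
      (\<And>t. t \<in> S \<Longrightarrow> complex.has_value (\<sigma> X) (point (x t) (y t) (z t) (w t) (q t) (p t) t a) (x' (\<epsilon> * t))) \<Longrightarrow>
      (\<And>t. t \<in> S \<Longrightarrow> complex.has_value (\<sigma> Y) (point (x t) (y t) (z t) (w t) (q t) (p t) t a) (y' (\<epsilon> * t))) \<Longrightarrow>
      (\<And>t. t \<in> S \<Longrightarrow> complex.has_value (\<sigma> Z) (point (x t) (y t) (z t) (w t) (q t) (p t) t a) (z' (\<epsilon> * t))) \<Longrightarrow>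
      (\<And>t. t \<in> S \<Longrightarrow> complex.has_value (\<sigma> W) (point (x t) (y t) (z t) (w t) (q t) (p t) t a) (w' (\<epsilon> * t))) \<Longrightarrow>
      (\<And>t. t \<in> S \<Longrightarrow> complex.has_value (\<sigma> Q) (point (x t) (y t) (z t) (w t) (q t) (p t) t a) (q' (\<epsilon> * t))) \<Longrightarrow>
      (\<And>t. t \<in> S \<Longrightarrow> complex.has_value (\<sigma> P) (point (x t) (y t) (z t) (w t) (q t) (p t) t a) (p' (\<epsilon> * t))) \<Longrightarrow>
      (\<And>t i. t \<in> S \<Longrightarrow> i \<le> 4 \<Longrightarrow>
        complex.has_value (\<sigma> (rf_par i)) (point (x t) (y t) (z t) (w t) (q t) (p t) t a) (a' i)) \<Longrightarrow>
      solves a' ((\<lambda>t. \<epsilon> * t) ` S) x' y' z' w' q' p'"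
  shows "baecklund_transformation \<sigma>"
  unfolding baecklund_transformation_def Let_def rf_has_value_eq
proof (intro conjI allI impI)
  have "rf_const (-1) = -1"
    using ratfun.add[of "-1" 1] ratfun.zero by (simp add: ratfun.one eq_neg_iff_add_eq_0)
  then show "\<sigma> T = T \<or> \<sigma> T = - T"
    using T \<epsilon> by (auto simp: ratfun.one)
next
  fix a S x y z w q p a' \<tau> x' y' z' w' q' p'
  assume sol: "solves a S x y z w q p" and vals: "\<forall>t\<in>S.
    complex.has_value (\<sigma> X) (point (x t) (y t) (z t) (w t) (q t) (p t) t a) (x' (\<tau> t)) \<and>
    complex.has_value (\<sigma> Y) (point (x t) (y t) (z t) (w t) (q t) (p t) t a) (y' (\<tau> t)) \<and>
    complex.has_value (\<sigma> Z) (point (x t) (y t) (z t) (w t) (q t) (p t) t a) (z' (\<tau> t)) \<and>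
    complex.has_value (\<sigma> W) (point (x t) (y t) (z t) (w t) (q t) (p t) t a) (w' (\<tau> t)) \<and>
    complex.has_value (\<sigma> Q) (point (x t) (y t) (z t) (w t) (q t) (p t) t a) (q' (\<tau> t)) \<and>
    complex.has_value (\<sigma> P) (point (x t) (y t) (z t) (w t) (q t) (p t) t a) (p' (\<tau> t)) \<and>
    complex.has_value (\<sigma> T) (point (x t) (y t) (z t) (w t) (q t) (p t) t a) (\<tau> t) \<and>
    (\<forall>i\<le>4. complex.has_value (\<sigma> (rf_par i)) (point (x t) (y t) (z t) (w t) (q t) (p t) t a) (a' i))"
  have \<tau>: "\<tau> t = \<epsilon> * t" if "t \<in> S" for t
  proof (rule complex.has_value_unique)
    show "complex.has_value (\<sigma> T) (point (x t) (y t) (z t) (w t) (q t) (p t) t a) (\<tau> t)"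
      using vals that by blast
    show "complex.has_value (\<sigma> T) (point (x t) (y t) (z t) (w t) (q t) (p t) t a) (\<epsilon> * t)"
      unfolding T by (intro complex.has_value_mult complex.has_value_const point_values refl)
  qed
  then have "\<tau> ` S = (\<lambda>t. \<epsilon> * t) ` S" by (rule image_cong[OF refl])
  moreover have "solves a' ((\<lambda>t. \<epsilon> * t) ` S) x' y' z' w' q' p'"
    by (rule image[OF sol]) (use vals \<tau> in auto)
  ultimately show "solves a' (\<tau> ` S) x' y' z' w' q' p'" by simp
qed fact+

lemma rf_const_simps:
  "rf_const 0 = 0" "rf_const 1 = 1" "rf_const (- 1) = - 1" "rf_const 2 = 2" "rf_const (- 2) = - 2"
proof -
  have minus: "rf_const (- c) = - rf_const c" for c
    using ratfun.add[of "- c" c] ratfun.zero by (simp add: eq_neg_iff_add_eq_0)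
  have two: "rf_const 2 = 2"
    using ratfun.add[of 1 1] by (simp add: ratfun.one)
  show "rf_const 0 = 0" "rf_const 1 = 1" "rf_const (- 1) = - 1" "rf_const 2 = 2" "rf_const (- 2) = - 2"
    by (simp_all only: minus two ratfun.zero ratfun.one)
qed

lemma le_4_cases: "i \<le> 4 \<longleftrightarrow> i = 0 \<or> i = 1 \<or> i = 2 \<or> i = 3 \<or> i = (4 :: nat)"
  by linarith

text \<open>
  The reflection in the node \<open>i\<close> adds multiples of \<open>\<alpha>\<^sub>i\<close>; the coefficients \<open>c\<close> are the negated entries
  of the Cartan matrix.
\<close>
lemma affine_on_parameters_reflection:
  assumes "i \<le> 4" and "\<And>j. j \<le> 4 \<Longrightarrow> \<sigma> (rf_par j) = rf_par j + rf_const (c j) * rf_par i"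
  shows "affine_on_parameters \<sigma>"
proof -
  have "\<sigma> (rf_par j) = rf_const 0 +
      (\<Sum>k\<le>4. rf_const (of_bool (k = j) + c j * of_bool (k = i)) * rf_par k)" if "j \<le> 4" for j
  proof -
    have of_bool: "rf_const (of_bool b) * f = (if b then f else 0)" for b f
      by (simp add: ratfun.zero ratfun.one)
    show ?thesis
      using that assms
      by (simp add: ratfun.add ratfun.mult ratfun.zero distrib_right sum.distrib mult.assoc of_bool
          sum_distrib_left[symmetric])
  qed
  then show ?thesis
    unfolding affine_on_parameters_def
    by (intro exI[of _ "\<lambda>_. 0"] exI[of _ "\<lambda>j k. of_bool (k = j) + c j * of_bool (k = i)"]) blast
qed

lemma affine_flip: "affine_on_parameters flip"
proof -
  have "flip (rf_par j) = rf_const 0 + (\<Sum>k\<le>4. rf_const (of_bool (k = 4 - j)) * rf_par k)"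
    if "j \<le> 4" for j
  proof -
    have of_bool: "rf_const (of_bool b) * f = (if b then f else 0)" for b f
      by (simp add: ratfun.zero ratfun.one)
    have "flip (rf_par 0) = rf_par 4" "flip (rf_par 1) = rf_par 3" "flip (rf_par 2) = rf_par 2"
      "flip (rf_par 3) = rf_par 1" "flip (rf_par 4) = rf_par 0"
      by (simp_all only: flip_simps)
    then have "flip (rf_par j) = rf_par (4 - j)"
      using that by (auto simp: le_4_cases)
    then show ?thesis by (simp add: of_bool ratfun.zero)
  qed
  then show ?thesis
    unfolding affine_on_parameters_def
    by (intro exI[of _ "\<lambda>_. 0"] exI[of _ "\<lambda>j k. of_bool (k = 4 - j)"]) blast
qed

lemma affine_s0: "affine_on_parameters s0"
  by (rule affine_on_parameters_reflection[of 0 _ "(\<lambda>_. 0)(0 := -2, 1 := 2)"])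
    (auto simp: le_4_cases s0_simps rf_const_simps simp del: One_nat_def)

lemma affine_s1: "affine_on_parameters s1"
  by (rule affine_on_parameters_reflection[of 1 _ "(\<lambda>_. 0)(0 := 1, 1 := -2, 2 := 1)"])
    (auto simp: le_4_cases s1_simps rf_const_simps simp del: One_nat_def)

lemma affine_s2: "affine_on_parameters s2"
  by (rule affine_on_parameters_reflection[of 2 _ "(\<lambda>_. 0)(1 := 1, 2 := -2, 3 := 1)"])
    (auto simp: le_4_cases s2_simps rf_const_simps simp del: One_nat_def)

lemma affine_s3: "affine_on_parameters s3"
  by (rule affine_on_parameters_reflection[of 3 _ "(\<lambda>_. 0)(2 := 1, 3 := -2, 4 := 1)"])
    (auto simp: le_4_cases s3_simps rf_const_simps simp del: One_nat_def)

lemma affine_s4: "affine_on_parameters s4"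
  by (rule affine_on_parameters_reflection[of 4 _ "(\<lambda>_. 0)(3 := 2, 4 := -2)"])
    (auto simp: le_4_cases s4_simps rf_const_simps simp del: One_nat_def)

section \<open>Transformation of the vector field\<close>

text \<open>
  In these lemmas the denominators of the transformations are hidden in \<open>u = 1 / y\<close>, \<open>u = 1 / p\<close>,
  \<open>u = 1 / z\<close> and in \<open>r = \<alpha>\<^sub>i / f\<^sub>i\<close>, where \<open>f\<^sub>i\<close> is \<open>x - z\<close>, \<open>w\<close> or \<open>z q - 1\<close>. After multiplication with a
  power of \<open>t\<close> the claims are then polynomial identities modulo \<open>u y = 1\<close> or \<open>r f\<^sub>i = \<alpha>\<^sub>i\<close>. In the cases of \<open>s\<^sub>1, s\<^sub>2, s\<^sub>3\<close>
  \<open>f\<^sub>i = 0\<close> is an invariant divisor of the flow when \<open>\<alpha>\<^sub>i = 0\<close>; this is why the derivative \<open>dr\<close> of \<open>r\<close> is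
  again a polynomial in \<open>r\<close> and the coordinates over \<open>t\<close>, and the last claim of these
  lemmas is that \<open>dr\<close> is this derivative.
\<close>
lemma velocity_s0:
  assumes "t \<noteq> 0" "u * y = 1" "b 0 = - a 0" "b 1 = a 1 + 2 * a 0" "b 2 = a 2" "b 4 = a 4"
    and "F = - x - 2 * a 0 * u - u^2"
  shows "velocity_x b (- t) F (- y) (- z) (- w) (- q) (- p) = velocity_x a t x y z w q p
      - 2 * (a 0 + u) * velocity_y a t x y z w q p * u^2"
    and "velocity_y b (- t) F (- y) (- z) (- w) (- q) (- p) = velocity_y a t x y z w q p"
    and "velocity_z b (- t) F (- y) (- z) (- w) (- q) (- p) = velocity_z a t x y z w q p"
    and "velocity_w b (- t) F (- y) (- z) (- w) (- q) (- p) = velocity_w a t x y z w q p"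
    and "velocity_q b (- t) F (- y) (- z) (- w) (- q) (- p) = velocity_q a t x y z w q p"
    and "velocity_p b (- t) F (- y) (- z) (- w) (- q) (- p) = velocity_p a t x y z w q p"
  unfolding velocity_defs assms(3-7) using assms(1) by (simp_all add: divide_simps del: One_nat_def) (algebra | use assms(2) in algebra)+

lemma velocity_s1:
  assumes "t \<noteq> 0" "r * (x - z) = a 1" "b 0 = a 0 + a 1" "b 1 = - a 1" "b 2 = a 2 + a 1" "b 4 = a 4"
    and "dr = - r * (y * (x + z) + a 0 - r * z) / t"
  shows "velocity_x b t x (y - r) z (w + r) q p = velocity_x a t x y z w q p"
    and "velocity_y b t x (y - r) z (w + r) q p = velocity_y a t x y z w q p - dr"
    and "velocity_z b t x (y - r) z (w + r) q p = velocity_z a t x y z w q p"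
    and "velocity_w b t x (y - r) z (w + r) q p = velocity_w a t x y z w q p + dr"
    and "velocity_q b t x (y - r) z (w + r) q p = velocity_q a t x y z w q p"
    and "velocity_p b t x (y - r) z (w + r) q p = velocity_p a t x y z w q p"
    and "r * (velocity_x a t x y z w q p - velocity_z a t x y z w q p) = - (x - z) * dr"
  unfolding velocity_defs assms(3-7) using assms(1) by (simp_all add: divide_simps del: One_nat_def) (algebra | use assms(2) in algebra)+

lemma velocity_s2:
  assumes "t \<noteq> 0" "r * w = a 2" "b 0 = a 0" "b 1 = a 1 + a 2" "b 2 = - a 2" "b 4 = a 4"
    and "dr = r * (z * w + a 0 + a 1 + a 2 + 2 * y * z + r * y) / t"
  shows "velocity_x b t x y (z + r) w q p = velocity_x a t x y z w q p"
    and "velocity_y b t x y (z + r) w q p = velocity_y a t x y z w q p"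
    and "velocity_z b t x y (z + r) w q p = velocity_z a t x y z w q p + dr"
    and "velocity_w b t x y (z + r) w q p = velocity_w a t x y z w q p"
    and "velocity_q b t x y (z + r) w q p = velocity_q a t x y z w q p"
    and "velocity_p b t x y (z + r) w q p = velocity_p a t x y z w q p"
    and "r * velocity_w a t x y z w q p = - w * dr"
  unfolding velocity_defs assms(3-7) using assms(1) by (simp_all add: divide_simps del: One_nat_def) (algebra | use assms(2) in algebra)+

text \<open>
  The derivative of \<open>z q\<close> contains \<open>(\<alpha>\<^sub>0 + \<alpha>\<^sub>1 + \<alpha>\<^sub>2 + \<alpha>\<^sub>4 - 1) z q\<close>, which is \<open>- \<alpha>\<^sub>3 z q\<close> because the
  parameters sum to \<open>1\<close>.
\<close>
lemma velocity_s3: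
  assumes "t \<noteq> 0" "r * (z * q - 1) = a 3" "a 0 + a 1 + a 2 + a 3 + a 4 = 1"
    and "b 0 = a 0" "b 1 = a 1" "b 2 = a 2 + a 3" "b 4 = a 4 + a 3"
    and "dr = - r * (z * w + y * z + q * p - r * z * q) / t"
  shows "velocity_x b t x y z (w - r * q) q (p - r * z) = velocity_x a t x y z w q p"
    and "velocity_y b t x y z (w - r * q) q (p - r * z) = velocity_y a t x y z w q p"
    and "velocity_z b t x y z (w - r * q) q (p - r * z) = velocity_z a t x y z w q p"
    and "velocity_w b t x y z (w - r * q) q (p - r * z) =
      velocity_w a t x y z w q p - (dr * q + r * velocity_q a t x y z w q p)"
    and "velocity_q b t x y z (w - r * q) q (p - r * z) = velocity_q a t x y z w q p"
    and "velocity_p b t x y z (w - r * q) q (p - r * z) =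
      velocity_p a t x y z w q p - (dr * z + r * velocity_z a t x y z w q p)"
    and "r * (velocity_z a t x y z w q p * q + z * velocity_q a t x y z w q p) = - (z * q - 1) * dr"
  unfolding velocity_defs assms(4-8) using assms(1) by (simp_all add: divide_simps del: One_nat_def) (algebra | use assms(2,3) in algebra)+

lemma velocity_s4:
  assumes "t \<noteq> 0" "u * p = 1" "b 0 = a 0" "b 1 = a 1" "b 2 = a 2" "b 4 = - a 4"
    and "F = q + 2 * a 4 * u - t * u^2"
  shows "velocity_x b (- t) x y z w F p = - velocity_x a t x y z w q p"
    and "velocity_y b (- t) x y z w F p = - velocity_y a t x y z w q p"
    and "velocity_z b (- t) x y z w F p = - velocity_z a t x y z w q p"
    and "velocity_w b (- t) x y z w F p = - velocity_w a t x y z w q p"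
    and "velocity_q b (- t) x y z w F p = - (velocity_q a t x y z w q p - u^2
      - 2 * (a 4 - t * u) * velocity_p a t x y z w q p * u^2)"
    and "velocity_p b (- t) x y z w F p = - velocity_p a t x y z w q p"
  unfolding velocity_defs assms(3-7) using assms(1) by (simp_all add: divide_simps del: One_nat_def) (algebra | use assms(2) in algebra)+

lemma velocity_flip:
  assumes "t \<noteq> 0" "u * z = 1" "a 0 + a 1 + a 2 + a 3 + a 4 = 1"
    and "b 0 = a 4" "b 1 = a 3" "b 2 = a 2" "b 4 = a 0"
    and "F = - t * q" "G = - p / t" "H = - t * u" "K = (z * w + a 2) * z / t" "L = - x / t" "M = - t * y"
  shows "velocity_x b t F G H K L M = - q - t * velocity_q a t x y z w q p"
    and "velocity_y b t F G H K L M = - velocity_p a t x y z w q p / t + p / t^2"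
    and "velocity_z b t F G H K L M = - u + t * velocity_z a t x y z w q p * u^2"
    and "velocity_w b t F G H K L M = ((2 * z * w + a 2) * velocity_z a t x y z w q p
        + z^2 * velocity_w a t x y z w q p) / t - (z * w + a 2) * z / t^2"
    and "velocity_q b t F G H K L M = - velocity_x a t x y z w q p / t + x / t^2"
    and "velocity_p b t F G H K L M = - y - t * velocity_y a t x y z w q p"
  unfolding velocity_defs assms(4-13) using assms(1) by (simp_all add: divide_simps del: One_nat_def) (algebra | use assms(2,3) in algebra)+

section \<open>The generators are Baecklund transformations\<close>

lemma solves_derivatives:
  assumes "solves a S x y z w q p" "t \<in> S"
  shows "(x has_field_derivative velocity_x a t (x t) (y t) (z t) (w t) (q t) (p t)) (at t)"
    and "(y has_field_derivative velocity_y a t (x t) (y t) (z t) (w t) (q t) (p t)) (at t)"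
    and "(z has_field_derivative velocity_z a t (x t) (y t) (z t) (w t) (q t) (p t)) (at t)"
    and "(w has_field_derivative velocity_w a t (x t) (y t) (z t) (w t) (q t) (p t)) (at t)"
    and "(q has_field_derivative velocity_q a t (x t) (y t) (z t) (w t) (q t) (p t)) (at t)"
    and "(p has_field_derivative velocity_p a t (x t) (y t) (z t) (w t) (q t) (p t)) (at t)"
  using assms unfolding solves_iff by blast+

text \<open>
  The hypothesis on \<open>r'\<close> is the form in which \<open>velocity_s1\<close>, \<open>velocity_s2\<close> and \<open>velocity_s3\<close> deliver the
  derivative of \<open>c / g\<close>.
\<close>
lemma DERIV_const_divide:
  fixes g :: "complex \<Rightarrow> complex"
  assumes "(g has_field_derivative g') (at t)" "g t \<noteq> 0" "c / g t * g' = - g t * r'"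
  shows "((\<lambda>s. c / g s) has_field_derivative r') (at t)"
  by (rule DERIV_cong[OF DERIV_divide[OF DERIV_const assms(1,2)]])
    (use assms(2,3) in \<open>simp add: field_simps\<close>)

lemma sum_atMost_4: "(\<Sum>i\<le>4. a i) = a 0 + a 1 + a 2 + a 3 + a (4 :: nat)"
  by (simp add: eval_nat_numeral)

lemmas value_intros = complex.has_value_add complex.has_value_minus complex.has_value_diff
  complex.has_value_mult complex.has_value_divide complex.has_value_power
  complex.has_value_numeral complex.has_value_1 point_values

lemmas value_var_intros = complex.has_value_add complex.has_value_minus complex.has_value_diff
  complex.has_value_mult complex.has_value_power complex.has_value_numeral complex.has_value_1
  complex.has_value_var complex.has_value_par

text \<open>
  The numerator \<open>- x y\<^sup>2 - 2 \<alpha>\<^sub>0 y - 1\<close> of \<open>s\<^sub>0(x)\<close> is \<open>- 1\<close> on \<open>y = 0\<close>, so that any variable other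
  than \<open>y\<close> can be moved to exclude zeros of \<open>y\<close> on \<open>S\<close>.
\<close>
lemma baecklund_s0: "baecklund_transformation s0"
proof (rule baecklund_transformationI[where \<epsilon> = "-1"])
  show "field_automorphism s0"
    by (rule s0.substitution_field_automorphism)
  show "affine_on_parameters s0"
    by (rule affine_s0)
  show "s0 T = rf_const (-1) * T"
    by (simp add: s0_simps rf_const_simps)
next
  fix a S x y z w q p a' x' y' z' w' q' p'
  let ?\<rho> = "\<lambda>t. point (x t) (y t) (z t) (w t) (q t) (p t) t a"
  assume sol: "solves a S x y z w q p"
  assume val:
    "\<And>t. t \<in> S \<Longrightarrow> complex.has_value (s0 X) (?\<rho> t) (x' (-1 * t))"
    "\<And>t. t \<in> S \<Longrightarrow> complex.has_value (s0 Y) (?\<rho> t) (y' (-1 * t))"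
    "\<And>t. t \<in> S \<Longrightarrow> complex.has_value (s0 Z) (?\<rho> t) (z' (-1 * t))"
    "\<And>t. t \<in> S \<Longrightarrow> complex.has_value (s0 W) (?\<rho> t) (w' (-1 * t))"
    "\<And>t. t \<in> S \<Longrightarrow> complex.has_value (s0 Q) (?\<rho> t) (q' (-1 * t))"
    "\<And>t. t \<in> S \<Longrightarrow> complex.has_value (s0 P) (?\<rho> t) (p' (-1 * t))"
  assume par: "\<And>t i. t \<in> S \<Longrightarrow> i \<le> 4 \<Longrightarrow>
    complex.has_value (s0 (rf_par i)) (?\<rho> t) (a' i)"
  have sum: "(\<Sum>i\<le>4. a i) = 1" and "S \<noteq> {}" and t: "\<And>t. t \<in> S \<Longrightarrow> t \<noteq> 0"
    using sol by (auto simp: solves_def)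
  then obtain s where s: "s \<in> S" by blast
  note vals = value_intros point_value_par[OF sum]
  have a': "a' 0 = - a 0" "a' 1 = a 1 + 2 * a 0" "a' 2 = a 2" "a' 3 = a 3" "a' 4 = a 4"
    by (rule complex.has_value_unique[OF par[OF s]], simp, simp only: s0_simps, intro vals,
        (simp; fail)+)+
  have nz: "y t \<noteq> 0" if "t \<in> S" for t
  proof
    assume eq: "y t = 0"
    show False
    proof (rule no_value_at_pole[OF val(1)[OF that], where u = VX])
      show "s0 X * (Y^2) = - X * Y^2 - 2 * rf_par 0 * Y - 1"
        by (simp add: s0_simps nonzero field_simps power2_eq_square)
      show "complex.has_value (Y^2) ((?\<rho> t)(VX := ?\<rho> t VX + e)) 0" for e
        by (rule complex.has_value_eqI[of _ _ "y t ^ 2"], intro value_var_intros)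
          (simp_all add: eq)
      show "complex.has_value (- X * Y^2 - 2 * rf_par 0 * Y - 1)
          ((?\<rho> t)(VX := ?\<rho> t VX + e)) (- (x t + e) * y t ^ 2 - 2 * a 0 * y t - 1)" for e
        by (intro value_var_intros) (simp_all add: eq)
      show "\<forall>\<^sub>F e in at 0. - (x t + e) * y t ^ 2 - 2 * a 0 * y t - 1 \<noteq> 0"
        by (simp add: eq)
    qed
  qed
  have im: "x' (-1 * t) = - x t - 2 * a 0 / y t - 1 / (y t)^2"
    "y' (-1 * t) = - y t"
    "z' (-1 * t) = - z t"
    "w' (-1 * t) = - w t"
    "q' (-1 * t) = - q t"
    "p' (-1 * t) = - p t"
    if "t \<in> S" for t
    by (rule complex.has_value_unique, rule val[OF that], simp only: s0_simps, intro vals,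
        ((simp add: nz[OF that] t[OF that]; fail)+)?)+
  let ?F = "\<lambda>t. - x t - 2 * a 0 / y t - 1 / (y t)^2"
    and ?G = "\<lambda>t. - y t"
    and ?H = "\<lambda>t. - z t"
    and ?K = "\<lambda>t. - w t"
    and ?L = "\<lambda>t. - q t"
    and ?M = "\<lambda>t. - p t"
  have sum': "(\<Sum>i\<le>4. a' i) = 1"
    using sum unfolding sum_atMost_4 a' by algebra
  show "solves a' ((\<lambda>t. -1 * t) ` S) x' y' z' w' q' p'"
  proof (rule solves_image[where F = ?F and G = ?G and H = ?H and K = ?K and L = ?L and M = ?M,
        OF sol sum' disjI2[OF refl] im])
    fix t assume "t \<in> S"
    note d = solves_derivatives[OF sol this]
    have nz': "t \<noteq> 0" "y t \<noteq> 0" using t nz \<open>t \<in> S\<close> by blast+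
    then have u: "1 / y t * y t = 1" by simp
    have F: "- x t - 2 * a 0 / y t - 1 / (y t)^2 = - x t - 2 * a 0 * (1 / y t) - (1 / y t)^2"
      by (simp add: power_divide)
    note v = velocity_s0[OF nz'(1) u a'(1,2,3,5) F]
    show "(?F has_field_derivative -1 * velocity_x a' (-1 * t)
        (?F t) (?G t) (?H t) (?K t) (?L t) (?M t)) (at t)"
      unfolding mult_minus1 mult_1_left v using nz'
      by (auto intro!: derivative_eq_intros d simp: field_simps power2_eq_square power3_eq_cube)
    show "(?G has_field_derivative -1 * velocity_y a' (-1 * t)
        (?F t) (?G t) (?H t) (?K t) (?L t) (?M t)) (at t)"
      unfolding mult_minus1 mult_1_left v using nz'
      by (auto intro!: derivative_eq_intros d simp: field_simps power2_eq_square power3_eq_cube)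
    show "(?H has_field_derivative -1 * velocity_z a' (-1 * t)
        (?F t) (?G t) (?H t) (?K t) (?L t) (?M t)) (at t)"
      unfolding mult_minus1 mult_1_left v using nz'
      by (auto intro!: derivative_eq_intros d simp: field_simps power2_eq_square power3_eq_cube)
    show "(?K has_field_derivative -1 * velocity_w a' (-1 * t)
        (?F t) (?G t) (?H t) (?K t) (?L t) (?M t)) (at t)"
      unfolding mult_minus1 mult_1_left v using nz'
      by (auto intro!: derivative_eq_intros d simp: field_simps power2_eq_square power3_eq_cube)
    show "(?L has_field_derivative -1 * velocity_q a' (-1 * t)
        (?F t) (?G t) (?H t) (?K t) (?L t) (?M t)) (at t)"
      unfolding mult_minus1 mult_1_left v using nz'
      by (auto intro!: derivative_eq_intros d simp: field_simps power2_eq_square power3_eq_cube)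
    show "(?M has_field_derivative -1 * velocity_p a' (-1 * t)
        (?F t) (?G t) (?H t) (?K t) (?L t) (?M t)) (at t)"
      unfolding mult_minus1 mult_1_left v using nz'
      by (auto intro!: derivative_eq_intros d simp: field_simps power2_eq_square power3_eq_cube)
  qed
qed simp

text \<open>
  On \<open>x = z\<close> the numerator \<open>y (x - z) - \<alpha>\<^sub>1\<close> of \<open>s\<^sub>1(y)\<close> is \<open>- \<alpha>\<^sub>1\<close>, so the parameter \<open>\<alpha>\<^sub>1\<close> is moved
  to make it nonzero. For \<open>s\<^sub>2\<close> the numerator of \<open>s\<^sub>2(z)\<close> is \<open>\<alpha>\<^sub>2\<close> on \<open>w = 0\<close>, and for \<open>s\<^sub>3\<close> that of \<open>s\<^sub>3(w)\<close> is
  \<open>- \<alpha>\<^sub>3 q\<close> on \<open>z q = 1\<close>, where \<open>q\<close> is nonzero; again the parameter is moved.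
\<close>
lemma baecklund_s1: "baecklund_transformation s1"
proof (rule baecklund_transformationI[where \<epsilon> = "1"])
  show "field_automorphism s1"
    by (rule s1.substitution_field_automorphism)
  show "affine_on_parameters s1"
    by (rule affine_s1)
  show "s1 T = rf_const 1 * T"
    by (simp add: s1_simps rf_const_simps)
next
  fix a S x y z w q p a' x' y' z' w' q' p'
  let ?\<rho> = "\<lambda>t. point (x t) (y t) (z t) (w t) (q t) (p t) t a"
  assume sol: "solves a S x y z w q p"
  assume val:
    "\<And>t. t \<in> S \<Longrightarrow> complex.has_value (s1 X) (?\<rho> t) (x' (1 * t))"
    "\<And>t. t \<in> S \<Longrightarrow> complex.has_value (s1 Y) (?\<rho> t) (y' (1 * t))"
    "\<And>t. t \<in> S \<Longrightarrow> complex.has_value (s1 Z) (?\<rho> t) (z' (1 * t))"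
    "\<And>t. t \<in> S \<Longrightarrow> complex.has_value (s1 W) (?\<rho> t) (w' (1 * t))"
    "\<And>t. t \<in> S \<Longrightarrow> complex.has_value (s1 Q) (?\<rho> t) (q' (1 * t))"
    "\<And>t. t \<in> S \<Longrightarrow> complex.has_value (s1 P) (?\<rho> t) (p' (1 * t))"
  assume par: "\<And>t i. t \<in> S \<Longrightarrow> i \<le> 4 \<Longrightarrow>
    complex.has_value (s1 (rf_par i)) (?\<rho> t) (a' i)"
  have sum: "(\<Sum>i\<le>4. a i) = 1" and "S \<noteq> {}" and t: "\<And>t. t \<in> S \<Longrightarrow> t \<noteq> 0"
    using sol by (auto simp: solves_def)
  then obtain s where s: "s \<in> S" by blast
  note vals = value_intros point_value_par[OF sum]
  have a': "a' 0 = a 0 + a 1" "a' 1 = - a 1" "a' 2 = a 2 + a 1" "a' 3 = a 3" "a' 4 = a 4"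
    by (rule complex.has_value_unique[OF par[OF s]], simp, simp only: s1_simps, intro vals,
        (simp; fail)+)+
  have nz: "x t \<noteq> z t" if "t \<in> S" for t
  proof
    assume eq: "x t = z t"
    show False
    proof (rule no_value_at_pole[OF val(2)[OF that], where u = VA1])
      show "s1 Y * (X - Z) = Y * (X - Z) - rf_par 1"
        by (simp add: s1_simps nonzero field_simps power2_eq_square)
      show "complex.has_value (X - Z) ((?\<rho> t)(VA1 := ?\<rho> t VA1 + e)) 0" for e
        by (rule complex.has_value_eqI[of _ _ "x t - z t"], intro value_var_intros)
          (simp_all add: eq)
      show "complex.has_value (Y * (X - Z) - rf_par 1)
          ((?\<rho> t)(VA1 := ?\<rho> t VA1 + e)) (y t * (x t - z t) - (a 1 + e))" for e
        by (intro value_var_intros) (simp_all add: eq)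
      show "\<forall>\<^sub>F e in at 0. y t * (x t - z t) - (a 1 + e) \<noteq> 0"
        using eventually_neq_at_within[of "- a 1" 0 UNIV]
        by eventually_elim (auto simp: eq add_eq_0_iff)
    qed
  qed
  have im: "x' (1 * t) = x t"
    "y' (1 * t) = y t - a 1 / (x t - z t)"
    "z' (1 * t) = z t"
    "w' (1 * t) = w t + a 1 / (x t - z t)"
    "q' (1 * t) = q t"
    "p' (1 * t) = p t"
    if "t \<in> S" for t
    by (rule complex.has_value_unique, rule val[OF that], simp only: s1_simps, intro vals,
        ((simp add: nz[OF that] t[OF that]; fail)+)?)+
  let ?F = "\<lambda>t. x t"
    and ?G = "\<lambda>t. y t - a 1 / (x t - z t)"
    and ?H = "\<lambda>t. z t"
    and ?K = "\<lambda>t. w t + a 1 / (x t - z t)"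
    and ?L = "\<lambda>t. q t"
    and ?M = "\<lambda>t. p t"
  have sum': "(\<Sum>i\<le>4. a' i) = 1"
    using sum unfolding sum_atMost_4 a' by algebra
  show "solves a' ((\<lambda>t. 1 * t) ` S) x' y' z' w' q' p'"
  proof (rule solves_image[where F = ?F and G = ?G and H = ?H and K = ?K and L = ?L and M = ?M,
        OF sol sum' disjI1[OF refl] im])
    fix t assume "t \<in> S"
    note d = solves_derivatives[OF sol this]
    define r where "r = a 1 / (x t - z t)"
    define r' where "r' = - r * (y t * (x t + z t) + a 0 - r * z t) / t"
    have nz: "t \<noteq> 0" "x t - z t \<noteq> 0" using t nz \<open>t \<in> S\<close> by auto
    then have r: "r * (x t - z t) = a 1" by (simp add: r_def)
    note v = velocity_s1[OF nz(1) r a'(1,2,3,5) r'_def]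
    have dg: "((\<lambda>t. x t - z t) has_field_derivative velocity_x a t (x t) (y t) (z t) (w t) (q t) (p t)
        - velocity_z a t (x t) (y t) (z t) (w t) (q t) (p t)) (at t)"
      by (auto intro!: derivative_eq_intros d)
    have dr: "((\<lambda>t. a 1 / (x t - z t)) has_field_derivative r') (at t)"
      by (rule DERIV_const_divide[OF dg nz(2) v(7)[unfolded r_def]])
    note v = v(1-6)[unfolded r_def]
    show "(?F has_field_derivative 1 * velocity_x a' (1 * t)
        (?F t) (?G t) (?H t) (?K t) (?L t) (?M t)) (at t)"
      unfolding mult_1_left v by (rule d(1))
    show "(?G has_field_derivative 1 * velocity_y a' (1 * t)
        (?F t) (?G t) (?H t) (?K t) (?L t) (?M t)) (at t)"
      unfolding mult_1_left v by (rule DERIV_diff[OF d(2) dr])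
    show "(?H has_field_derivative 1 * velocity_z a' (1 * t)
        (?F t) (?G t) (?H t) (?K t) (?L t) (?M t)) (at t)"
      unfolding mult_1_left v by (rule d(3))
    show "(?K has_field_derivative 1 * velocity_w a' (1 * t)
        (?F t) (?G t) (?H t) (?K t) (?L t) (?M t)) (at t)"
      unfolding mult_1_left v by (rule DERIV_add[OF d(4) dr])
    show "(?L has_field_derivative 1 * velocity_q a' (1 * t)
        (?F t) (?G t) (?H t) (?K t) (?L t) (?M t)) (at t)"
      unfolding mult_1_left v by (rule d(5))
    show "(?M has_field_derivative 1 * velocity_p a' (1 * t)
        (?F t) (?G t) (?H t) (?K t) (?L t) (?M t)) (at t)"
      unfolding mult_1_left v by (rule d(6))
  qed
qed simp

lemma baecklund_s2: "baecklund_transformation s2"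
proof (rule baecklund_transformationI[where \<epsilon> = "1"])
  show "field_automorphism s2"
    by (rule s2.substitution_field_automorphism)
  show "affine_on_parameters s2"
    by (rule affine_s2)
  show "s2 T = rf_const 1 * T"
    by (simp add: s2_simps rf_const_simps)
next
  fix a S x y z w q p a' x' y' z' w' q' p'
  let ?\<rho> = "\<lambda>t. point (x t) (y t) (z t) (w t) (q t) (p t) t a"
  assume sol: "solves a S x y z w q p"
  assume val:
    "\<And>t. t \<in> S \<Longrightarrow> complex.has_value (s2 X) (?\<rho> t) (x' (1 * t))"
    "\<And>t. t \<in> S \<Longrightarrow> complex.has_value (s2 Y) (?\<rho> t) (y' (1 * t))"
    "\<And>t. t \<in> S \<Longrightarrow> complex.has_value (s2 Z) (?\<rho> t) (z' (1 * t))"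
    "\<And>t. t \<in> S \<Longrightarrow> complex.has_value (s2 W) (?\<rho> t) (w' (1 * t))"
    "\<And>t. t \<in> S \<Longrightarrow> complex.has_value (s2 Q) (?\<rho> t) (q' (1 * t))"
    "\<And>t. t \<in> S \<Longrightarrow> complex.has_value (s2 P) (?\<rho> t) (p' (1 * t))"
  assume par: "\<And>t i. t \<in> S \<Longrightarrow> i \<le> 4 \<Longrightarrow>
    complex.has_value (s2 (rf_par i)) (?\<rho> t) (a' i)"
  have sum: "(\<Sum>i\<le>4. a i) = 1" and "S \<noteq> {}" and t: "\<And>t. t \<in> S \<Longrightarrow> t \<noteq> 0"
    using sol by (auto simp: solves_def)
  then obtain s where s: "s \<in> S" by blast
  note vals = value_intros point_value_par[OF sum]
  have a': "a' 0 = a 0" "a' 1 = a 1 + a 2" "a' 2 = - a 2" "a' 3 = a 3 + a 2" "a' 4 = a 4"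
    by (rule complex.has_value_unique[OF par[OF s]], simp, simp only: s2_simps, intro vals,
        (simp; fail)+)+
  have nz: "w t \<noteq> 0" if "t \<in> S" for t
  proof
    assume eq: "w t = 0"
    show False
    proof (rule no_value_at_pole[OF val(3)[OF that], where u = VA2])
      show "s2 Z * (W) = Z * W + rf_par 2"
        by (simp add: s2_simps nonzero field_simps power2_eq_square)
      show "complex.has_value (W) ((?\<rho> t)(VA2 := ?\<rho> t VA2 + e)) 0" for e
        by (rule complex.has_value_eqI[of _ _ "w t"], intro value_var_intros)
          (simp_all add: eq)
      show "complex.has_value (Z * W + rf_par 2)
          ((?\<rho> t)(VA2 := ?\<rho> t VA2 + e)) (z t * w t + (a 2 + e))" for e
        by (intro value_var_intros) (simp_all add: eq)
      show "\<forall>\<^sub>F e in at 0. z t * w t + (a 2 + e) \<noteq> 0"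
        using eventually_neq_at_within[of "- a 2" 0 UNIV]
        by eventually_elim (auto simp: eq add_eq_0_iff)
    qed
  qed
  have im: "x' (1 * t) = x t"
    "y' (1 * t) = y t"
    "z' (1 * t) = z t + a 2 / w t"
    "w' (1 * t) = w t"
    "q' (1 * t) = q t"
    "p' (1 * t) = p t"
    if "t \<in> S" for t
    by (rule complex.has_value_unique, rule val[OF that], simp only: s2_simps, intro vals,
        ((simp add: nz[OF that] t[OF that]; fail)+)?)+
  let ?F = "\<lambda>t. x t"
    and ?G = "\<lambda>t. y t"
    and ?H = "\<lambda>t. z t + a 2 / w t"
    and ?K = "\<lambda>t. w t"
    and ?L = "\<lambda>t. q t"
    and ?M = "\<lambda>t. p t"
  have sum': "(\<Sum>i\<le>4. a' i) = 1"
    using sum unfolding sum_atMost_4 a' by algebra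
  show "solves a' ((\<lambda>t. 1 * t) ` S) x' y' z' w' q' p'"
  proof (rule solves_image[where F = ?F and G = ?G and H = ?H and K = ?K and L = ?L and M = ?M,
        OF sol sum' disjI1[OF refl] im])
    fix t assume "t \<in> S"
    note d = solves_derivatives[OF sol this]
    define r where "r = a 2 / w t"
    define r' where "r' = r * (z t * w t + a 0 + a 1 + a 2 + 2 * y t * z t + r * y t) / t"
    have nz: "t \<noteq> 0" "w t \<noteq> 0" using t nz \<open>t \<in> S\<close> by auto
    then have r: "r * w t = a 2" by (simp add: r_def)
    note v = velocity_s2[OF nz(1) r a'(1,2,3,5) r'_def]
    have dg: "(w has_field_derivative velocity_w a t (x t) (y t) (z t) (w t) (q t) (p t)) (at t)"
      by (auto intro!: derivative_eq_intros d)
    have dr: "((\<lambda>t. a 2 / w t) has_field_derivative r') (at t)"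
      by (rule DERIV_const_divide[OF dg nz(2) v(7)[unfolded r_def]])
    note v = v(1-6)[unfolded r_def]
    show "(?F has_field_derivative 1 * velocity_x a' (1 * t)
        (?F t) (?G t) (?H t) (?K t) (?L t) (?M t)) (at t)"
      unfolding mult_1_left v by (rule d(1))
    show "(?G has_field_derivative 1 * velocity_y a' (1 * t)
        (?F t) (?G t) (?H t) (?K t) (?L t) (?M t)) (at t)"
      unfolding mult_1_left v by (rule d(2))
    show "(?H has_field_derivative 1 * velocity_z a' (1 * t)
        (?F t) (?G t) (?H t) (?K t) (?L t) (?M t)) (at t)"
      unfolding mult_1_left v by (rule DERIV_add[OF d(3) dr])
    show "(?K has_field_derivative 1 * velocity_w a' (1 * t)
        (?F t) (?G t) (?H t) (?K t) (?L t) (?M t)) (at t)"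
      unfolding mult_1_left v by (rule d(4))
    show "(?L has_field_derivative 1 * velocity_q a' (1 * t)
        (?F t) (?G t) (?H t) (?K t) (?L t) (?M t)) (at t)"
      unfolding mult_1_left v by (rule d(5))
    show "(?M has_field_derivative 1 * velocity_p a' (1 * t)
        (?F t) (?G t) (?H t) (?K t) (?L t) (?M t)) (at t)"
      unfolding mult_1_left v by (rule d(6))
  qed
qed simp

lemma baecklund_s3: "baecklund_transformation s3"
proof (rule baecklund_transformationI[where \<epsilon> = "1"])
  show "field_automorphism s3"
    by (rule s3.substitution_field_automorphism)
  show "affine_on_parameters s3"
    by (rule affine_s3)
  show "s3 T = rf_const 1 * T"
    by (simp add: s3_simps rf_const_simps)
next
  fix a S x y z w q p a' x' y' z' w' q' p'
  let ?\<rho> = "\<lambda>t. point (x t) (y t) (z t) (w t) (q t) (p t) t a"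
  assume sol: "solves a S x y z w q p"
  assume val:
    "\<And>t. t \<in> S \<Longrightarrow> complex.has_value (s3 X) (?\<rho> t) (x' (1 * t))"
    "\<And>t. t \<in> S \<Longrightarrow> complex.has_value (s3 Y) (?\<rho> t) (y' (1 * t))"
    "\<And>t. t \<in> S \<Longrightarrow> complex.has_value (s3 Z) (?\<rho> t) (z' (1 * t))"
    "\<And>t. t \<in> S \<Longrightarrow> complex.has_value (s3 W) (?\<rho> t) (w' (1 * t))"
    "\<And>t. t \<in> S \<Longrightarrow> complex.has_value (s3 Q) (?\<rho> t) (q' (1 * t))"
    "\<And>t. t \<in> S \<Longrightarrow> complex.has_value (s3 P) (?\<rho> t) (p' (1 * t))"
  assume par: "\<And>t i. t \<in> S \<Longrightarrow> i \<le> 4 \<Longrightarrow>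
    complex.has_value (s3 (rf_par i)) (?\<rho> t) (a' i)"
  have sum: "(\<Sum>i\<le>4. a i) = 1" and "S \<noteq> {}" and t: "\<And>t. t \<in> S \<Longrightarrow> t \<noteq> 0"
    using sol by (auto simp: solves_def)
  then obtain s where s: "s \<in> S" by blast
  note vals = value_intros point_value_par[OF sum]
  have a': "a' 0 = a 0" "a' 1 = a 1" "a' 2 = a 2 + a 3" "a' 3 = - a 3" "a' 4 = a 4 + a 3"
    by (rule complex.has_value_unique[OF par[OF s]], simp, simp only: s3_simps, intro vals,
        (simp; fail)+)+
  have nz: "z t * q t \<noteq> 1" if "t \<in> S" for t
  proof
    assume eq: "z t * q t = 1"
    then have eq_q: "q t \<noteq> 0" by auto
    show False
    proof (rule no_value_at_pole[OF val(4)[OF that], where u = VA3])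
      show "s3 W * (Z * Q - 1) = W * (Z * Q - 1) - rf_par 3 * Q"
        by (simp add: s3_simps nonzero left_diff_distrib)
      show "complex.has_value (Z * Q - 1) ((?\<rho> t)(VA3 := ?\<rho> t VA3 + e)) 0" for e
        by (rule complex.has_value_eqI[of _ _ "z t * q t - 1"], intro value_var_intros)
          (simp_all add: eq)
      show "complex.has_value (W * (Z * Q - 1) - rf_par 3 * Q)
          ((?\<rho> t)(VA3 := ?\<rho> t VA3 + e)) (w t * (z t * q t - 1) - (a 3 + e) * q t)" for e
        by (intro value_var_intros) (simp_all add: eq)
      show "\<forall>\<^sub>F e in at 0. w t * (z t * q t - 1) - (a 3 + e) * q t \<noteq> 0"
        using eventually_neq_at_within[of "- a 3" 0 UNIV]
        by eventually_elim (auto simp: eq add_eq_0_iff eq_q)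
    qed
  qed
  have im: "x' (1 * t) = x t"
    "y' (1 * t) = y t"
    "z' (1 * t) = z t"
    "w' (1 * t) = w t - a 3 * q t / (z t * q t - 1)"
    "q' (1 * t) = q t"
    "p' (1 * t) = p t - a 3 * z t / (z t * q t - 1)"
    if "t \<in> S" for t
    by (rule complex.has_value_unique, rule val[OF that], simp only: s3_simps, intro vals,
        ((simp add: nz[OF that] t[OF that]; fail)+)?)+
  let ?F = "\<lambda>t. x t"
    and ?G = "\<lambda>t. y t"
    and ?H = "\<lambda>t. z t"
    and ?K = "\<lambda>t. w t - a 3 * q t / (z t * q t - 1)"
    and ?L = "\<lambda>t. q t"
    and ?M = "\<lambda>t. p t - a 3 * z t / (z t * q t - 1)"
  have sum': "(\<Sum>i\<le>4. a' i) = 1"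
    using sum unfolding sum_atMost_4 a' by algebra
  show "solves a' ((\<lambda>t. 1 * t) ` S) x' y' z' w' q' p'"
  proof (rule solves_image[where F = ?F and G = ?G and H = ?H and K = ?K and L = ?L and M = ?M,
        OF sol sum' disjI1[OF refl] im])
    fix t assume "t \<in> S"
    note d = solves_derivatives[OF sol this]
    define r where "r = a 3 / (z t * q t - 1)"
    define r' where "r' = - r * (z t * w t + y t * z t + q t * p t - r * z t * q t) / t"
    have nz: "t \<noteq> 0" "z t * q t - 1 \<noteq> 0" using t nz \<open>t \<in> S\<close> by auto
    then have r: "r * (z t * q t - 1) = a 3" by (simp add: r_def)
    note v = velocity_s3[OF nz(1) r sum[unfolded sum_atMost_4] a'(1,2,3,5) r'_def]
    have dg: "((\<lambda>t. z t * q t - 1) has_field_derivative velocity_z a t (x t) (y t) (z t) (w t) (q t) (p t) * q t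
        + z t * velocity_q a t (x t) (y t) (z t) (w t) (q t) (p t)) (at t)"
      by (auto intro!: derivative_eq_intros d)
    have dr: "((\<lambda>t. a 3 / (z t * q t - 1)) has_field_derivative r') (at t)"
      by (rule DERIV_const_divide[OF dg nz(2) v(7)[unfolded r_def]])
    note v = v(1-6)[unfolded r_def times_divide_eq_left]
    show "(?F has_field_derivative 1 * velocity_x a' (1 * t)
        (?F t) (?G t) (?H t) (?K t) (?L t) (?M t)) (at t)"
      unfolding mult_1_left v by (rule d(1))
    show "(?G has_field_derivative 1 * velocity_y a' (1 * t)
        (?F t) (?G t) (?H t) (?K t) (?L t) (?M t)) (at t)"
      unfolding mult_1_left v by (rule d(2))
    show "(?H has_field_derivative 1 * velocity_z a' (1 * t)
        (?F t) (?G t) (?H t) (?K t) (?L t) (?M t)) (at t)"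
      unfolding mult_1_left v by (rule d(3))
    show "(?K has_field_derivative 1 * velocity_w a' (1 * t)
        (?F t) (?G t) (?H t) (?K t) (?L t) (?M t)) (at t)"
      unfolding mult_1_left v by (rule DERIV_cong[OF DERIV_diff[OF d(4) DERIV_mult[OF dr d(5), unfolded times_divide_eq_left]]])
        simp
    show "(?L has_field_derivative 1 * velocity_q a' (1 * t)
        (?F t) (?G t) (?H t) (?K t) (?L t) (?M t)) (at t)"
      unfolding mult_1_left v by (rule d(5))
    show "(?M has_field_derivative 1 * velocity_p a' (1 * t)
        (?F t) (?G t) (?H t) (?K t) (?L t) (?M t)) (at t)"
      unfolding mult_1_left v by (rule DERIV_cong[OF DERIV_diff[OF d(6) DERIV_mult[OF dr d(3), unfolded times_divide_eq_left]]])
        simp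
  qed
qed simp

text \<open>
  On \<open>p = 0\<close> the numerator \<open>q p\<^sup>2 + 2 \<alpha>\<^sub>4 p - t\<close> of \<open>s\<^sub>4(q)\<close> is \<open>- t\<close>, which is nonzero on \<open>S\<close>.
\<close>
lemma baecklund_s4: "baecklund_transformation s4"
proof (rule baecklund_transformationI[where \<epsilon> = "-1"])
  show "field_automorphism s4"
    by (rule s4.substitution_field_automorphism)
  show "affine_on_parameters s4"
    by (rule affine_s4)
  show "s4 T = rf_const (-1) * T"
    by (simp add: s4_simps rf_const_simps)
next
  fix a S x y z w q p a' x' y' z' w' q' p'
  let ?\<rho> = "\<lambda>t. point (x t) (y t) (z t) (w t) (q t) (p t) t a"
  assume sol: "solves a S x y z w q p"
  assume val:
    "\<And>t. t \<in> S \<Longrightarrow> complex.has_value (s4 X) (?\<rho> t) (x' (-1 * t))"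
    "\<And>t. t \<in> S \<Longrightarrow> complex.has_value (s4 Y) (?\<rho> t) (y' (-1 * t))"
    "\<And>t. t \<in> S \<Longrightarrow> complex.has_value (s4 Z) (?\<rho> t) (z' (-1 * t))"
    "\<And>t. t \<in> S \<Longrightarrow> complex.has_value (s4 W) (?\<rho> t) (w' (-1 * t))"
    "\<And>t. t \<in> S \<Longrightarrow> complex.has_value (s4 Q) (?\<rho> t) (q' (-1 * t))"
    "\<And>t. t \<in> S \<Longrightarrow> complex.has_value (s4 P) (?\<rho> t) (p' (-1 * t))"
  assume par: "\<And>t i. t \<in> S \<Longrightarrow> i \<le> 4 \<Longrightarrow>
    complex.has_value (s4 (rf_par i)) (?\<rho> t) (a' i)"
  have sum: "(\<Sum>i\<le>4. a i) = 1" and "S \<noteq> {}" and t: "\<And>t. t \<in> S \<Longrightarrow> t \<noteq> 0"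
    using sol by (auto simp: solves_def)
  then obtain s where s: "s \<in> S" by blast
  note vals = value_intros point_value_par[OF sum]
  have a': "a' 0 = a 0" "a' 1 = a 1" "a' 2 = a 2" "a' 3 = a 3 + 2 * a 4" "a' 4 = - a 4"
    by (rule complex.has_value_unique[OF par[OF s]], simp, simp only: s4_simps, intro vals,
        (simp; fail)+)+
  have nz: "p t \<noteq> 0" if "t \<in> S" for t
  proof
    assume eq: "p t = 0"
    have a4: "a 4 = 1 - a 0 - a 1 - a 2 - a 3"
      using sum by (simp add: sum_atMost_4 algebra_simps)
    show False
    proof (rule no_value_at_pole[OF val(5)[OF that], where u = VX])
      show "s4 Q * (P^2) = Q * P^2 + 2 * rf_par 4 * P - T"
        by (simp add: s4_simps nonzero field_simps power2_eq_square)
      show "complex.has_value (P^2) ((?\<rho> t)(VX := ?\<rho> t VX + e)) 0" for e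
        by (rule complex.has_value_eqI[of _ _ "p t ^ 2"], intro value_var_intros)
          (simp_all add: eq)
      show "complex.has_value (Q * P^2 + 2 * rf_par 4 * P - T)
          ((?\<rho> t)(VX := ?\<rho> t VX + e)) (q t * p t ^ 2 + 2 * a 4 * p t - t)" for e
        by (intro value_var_intros) (simp_all add: eq a4)
      show "\<forall>\<^sub>F e in at 0. q t * p t ^ 2 + 2 * a 4 * p t - t \<noteq> 0"
        using t[OF that] by (simp add: eq)
    qed
  qed
  have im: "x' (-1 * t) = x t"
    "y' (-1 * t) = y t"
    "z' (-1 * t) = z t"
    "w' (-1 * t) = w t"
    "q' (-1 * t) = q t + 2 * a 4 / p t - t / (p t)^2"
    "p' (-1 * t) = p t"
    if "t \<in> S" for t
    by (rule complex.has_value_unique, rule val[OF that], simp only: s4_simps, intro vals,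
        ((simp add: nz[OF that] t[OF that]; fail)+)?)+
  let ?F = "\<lambda>t. x t"
    and ?G = "\<lambda>t. y t"
    and ?H = "\<lambda>t. z t"
    and ?K = "\<lambda>t. w t"
    and ?L = "\<lambda>t. q t + 2 * a 4 / p t - t / (p t)^2"
    and ?M = "\<lambda>t. p t"
  have sum': "(\<Sum>i\<le>4. a' i) = 1"
    using sum unfolding sum_atMost_4 a' by algebra
  show "solves a' ((\<lambda>t. -1 * t) ` S) x' y' z' w' q' p'"
  proof (rule solves_image[where F = ?F and G = ?G and H = ?H and K = ?K and L = ?L and M = ?M,
        OF sol sum' disjI2[OF refl] im])
    fix t assume "t \<in> S"
    note d = solves_derivatives[OF sol this]
    have nz': "t \<noteq> 0" "p t \<noteq> 0" using t nz \<open>t \<in> S\<close> by blast+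
    then have u: "1 / p t * p t = 1" by simp
    have F: "q t + 2 * a 4 / p t - t / (p t)^2 = q t + 2 * a 4 * (1 / p t) - t * (1 / p t)^2"
      by (simp add: power_divide)
    note v = velocity_s4[OF nz'(1) u a'(1,2,3,5) F]
    show "(?F has_field_derivative -1 * velocity_x a' (-1 * t)
        (?F t) (?G t) (?H t) (?K t) (?L t) (?M t)) (at t)"
      unfolding mult_minus1 mult_1_left v using nz'
      by (auto intro!: derivative_eq_intros d simp: field_simps power2_eq_square power3_eq_cube)
    show "(?G has_field_derivative -1 * velocity_y a' (-1 * t)
        (?F t) (?G t) (?H t) (?K t) (?L t) (?M t)) (at t)"
      unfolding mult_minus1 mult_1_left v using nz'
      by (auto intro!: derivative_eq_intros d simp: field_simps power2_eq_square power3_eq_cube)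
    show "(?H has_field_derivative -1 * velocity_z a' (-1 * t)
        (?F t) (?G t) (?H t) (?K t) (?L t) (?M t)) (at t)"
      unfolding mult_minus1 mult_1_left v using nz'
      by (auto intro!: derivative_eq_intros d simp: field_simps power2_eq_square power3_eq_cube)
    show "(?K has_field_derivative -1 * velocity_w a' (-1 * t)
        (?F t) (?G t) (?H t) (?K t) (?L t) (?M t)) (at t)"
      unfolding mult_minus1 mult_1_left v using nz'
      by (auto intro!: derivative_eq_intros d simp: field_simps power2_eq_square power3_eq_cube)
    show "(?L has_field_derivative -1 * velocity_q a' (-1 * t)
        (?F t) (?G t) (?H t) (?K t) (?L t) (?M t)) (at t)"
      unfolding mult_minus1 mult_1_left v using nz'
      by (auto intro!: derivative_eq_intros d simp: field_simps power2_eq_square power3_eq_cube)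
    show "(?M has_field_derivative -1 * velocity_p a' (-1 * t)
        (?F t) (?G t) (?H t) (?K t) (?L t) (?M t)) (at t)"
      unfolding mult_minus1 mult_1_left v using nz'
      by (auto intro!: derivative_eq_intros d simp: field_simps power2_eq_square power3_eq_cube)
  qed
qed simp

text \<open>
  The only denominator besides \<open>t\<close> is that of \<open>\<pi>(z) = - t / z\<close>, whose numerator is nonzero on \<open>S\<close>.
\<close>
lemma baecklund_flip: "baecklund_transformation flip"
proof (rule baecklund_transformationI[where \<epsilon> = "1"])
  show "field_automorphism flip"
    by (rule flip.substitution_field_automorphism)
  show "affine_on_parameters flip"
    by (rule affine_flip)
  show "flip T = rf_const 1 * T"
    by (simp add: flip_simps rf_const_simps)
next
  fix a S x y z w q p a' x' y' z' w' q' p'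
  let ?\<rho> = "\<lambda>t. point (x t) (y t) (z t) (w t) (q t) (p t) t a"
  assume sol: "solves a S x y z w q p"
  assume val:
    "\<And>t. t \<in> S \<Longrightarrow> complex.has_value (flip X) (?\<rho> t) (x' (1 * t))"
    "\<And>t. t \<in> S \<Longrightarrow> complex.has_value (flip Y) (?\<rho> t) (y' (1 * t))"
    "\<And>t. t \<in> S \<Longrightarrow> complex.has_value (flip Z) (?\<rho> t) (z' (1 * t))"
    "\<And>t. t \<in> S \<Longrightarrow> complex.has_value (flip W) (?\<rho> t) (w' (1 * t))"
    "\<And>t. t \<in> S \<Longrightarrow> complex.has_value (flip Q) (?\<rho> t) (q' (1 * t))"
    "\<And>t. t \<in> S \<Longrightarrow> complex.has_value (flip P) (?\<rho> t) (p' (1 * t))"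
  assume par: "\<And>t i. t \<in> S \<Longrightarrow> i \<le> 4 \<Longrightarrow>
    complex.has_value (flip (rf_par i)) (?\<rho> t) (a' i)"
  have sum: "(\<Sum>i\<le>4. a i) = 1" and "S \<noteq> {}" and t: "\<And>t. t \<in> S \<Longrightarrow> t \<noteq> 0"
    using sol by (auto simp: solves_def)
  then obtain s where s: "s \<in> S" by blast
  note vals = value_intros point_value_par[OF sum]
  have a': "a' 0 = a 4" "a' 1 = a 3" "a' 2 = a 2" "a' 3 = a 1" "a' 4 = a 0"
    by (rule complex.has_value_unique[OF par[OF s]], simp, simp only: flip_simps, intro vals,
        (simp; fail)+)+
  have nz: "z t \<noteq> 0" if "t \<in> S" for t
  proof
    assume eq: "z t = 0"
    show False
    proof (rule no_value_at_pole[OF val(3)[OF that], where u = VX])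
      show "flip Z * (Z) = - T"
        by (simp add: flip_simps nonzero field_simps power2_eq_square)
      show "complex.has_value (Z) ((?\<rho> t)(VX := ?\<rho> t VX + e)) 0" for e
        by (rule complex.has_value_eqI[of _ _ "z t"], intro value_var_intros)
          (simp_all add: eq)
      show "complex.has_value (- T)
          ((?\<rho> t)(VX := ?\<rho> t VX + e)) (- t)" for e
        by (intro value_var_intros) (simp_all add: eq)
      show "\<forall>\<^sub>F e in at 0. - t \<noteq> 0"
        using t[OF that] by simp
    qed
  qed
  have im: "x' (1 * t) = - t * q t"
    "y' (1 * t) = - p t / t"
    "z' (1 * t) = - t / z t"
    "w' (1 * t) = (z t * w t + a 2) * z t / t"
    "q' (1 * t) = - x t / t"
    "p' (1 * t) = - t * y t"
    if "t \<in> S" for t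
    by (rule complex.has_value_unique, rule val[OF that], simp only: flip_simps, intro vals,
        ((simp add: nz[OF that] t[OF that]; fail)+)?)+
  let ?F = "\<lambda>t. - t * q t"
    and ?G = "\<lambda>t. - p t / t"
    and ?H = "\<lambda>t. - t / z t"
    and ?K = "\<lambda>t. (z t * w t + a 2) * z t / t"
    and ?L = "\<lambda>t. - x t / t"
    and ?M = "\<lambda>t. - t * y t"
  have sum': "(\<Sum>i\<le>4. a' i) = 1"
    using sum unfolding sum_atMost_4 a' by algebra
  show "solves a' ((\<lambda>t. 1 * t) ` S) x' y' z' w' q' p'"
  proof (rule solves_image[where F = ?F and G = ?G and H = ?H and K = ?K and L = ?L and M = ?M,
        OF sol sum' disjI1[OF refl] im])
    fix t assume "t \<in> S"
    note d = solves_derivatives[OF sol this]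
    have nz': "t \<noteq> 0" "z t \<noteq> 0" using t nz \<open>t \<in> S\<close> by blast+
    then have u: "1 / z t * z t = 1" by simp
    have H: "- t / z t = - t * (1 / z t)" by simp
    note v = velocity_flip[OF nz'(1) u sum[unfolded sum_atMost_4] a'(1,2,3,5) refl refl H refl refl refl]
    show "(?F has_field_derivative 1 * velocity_x a' (1 * t)
        (?F t) (?G t) (?H t) (?K t) (?L t) (?M t)) (at t)"
      unfolding mult_minus1 mult_1_left v using nz'
      by (auto intro!: derivative_eq_intros d simp: field_simps power2_eq_square power3_eq_cube)
    show "(?G has_field_derivative 1 * velocity_y a' (1 * t)
        (?F t) (?G t) (?H t) (?K t) (?L t) (?M t)) (at t)"
      unfolding mult_minus1 mult_1_left v using nz'
      by (auto intro!: derivative_eq_intros d simp: field_simps power2_eq_square power3_eq_cube)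
    show "(?H has_field_derivative 1 * velocity_z a' (1 * t)
        (?F t) (?G t) (?H t) (?K t) (?L t) (?M t)) (at t)"
      unfolding mult_minus1 mult_1_left v using nz'
      by (auto intro!: derivative_eq_intros d simp: field_simps power2_eq_square power3_eq_cube)
    show "(?K has_field_derivative 1 * velocity_w a' (1 * t)
        (?F t) (?G t) (?H t) (?K t) (?L t) (?M t)) (at t)"
      unfolding mult_minus1 mult_1_left v using nz'
      by (auto intro!: derivative_eq_intros d simp: field_simps power2_eq_square power3_eq_cube)
    show "(?L has_field_derivative 1 * velocity_q a' (1 * t)
        (?F t) (?G t) (?H t) (?K t) (?L t) (?M t)) (at t)"
      unfolding mult_minus1 mult_1_left v using nz'
      by (auto intro!: derivative_eq_intros d simp: field_simps power2_eq_square power3_eq_cube)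
    show "(?M has_field_derivative 1 * velocity_p a' (1 * t)
        (?F t) (?G t) (?H t) (?K t) (?L t) (?M t)) (at t)"
      unfolding mult_minus1 mult_1_left v using nz'
      by (auto intro!: derivative_eq_intros d simp: field_simps power2_eq_square power3_eq_cube)
  qed
qed simp

theorem theorem4p5:
  fixes x y z w q p t :: ratfun and \<alpha> :: "nat \<Rightarrow> ratfun"
  assumes "x = rf_var VX" "y = rf_var VY" "z = rf_var VZ" "w = rf_var VW"
    and "q = rf_var VQ" "p = rf_var VP" "t = rf_var VT" "\<alpha> = rf_par"
  shows "\<exists>(s :: nat \<Rightarrow> ratfun \<Rightarrow> ratfun) (\<pi> :: ratfun \<Rightarrow> ratfun).
      acts_by (s 0) [- x - 2 * \<alpha> 0 / y - 1 / y^2, - y, - z, - w, - q, - p, - t]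
        [- \<alpha> 0, \<alpha> 1 + 2 * \<alpha> 0, \<alpha> 2, \<alpha> 3, \<alpha> 4] \<and>
      acts_by (s 1) [x, y - \<alpha> 1 / (x - z), z, w + \<alpha> 1 / (x - z), q, p, t]
        [\<alpha> 0 + \<alpha> 1, - \<alpha> 1, \<alpha> 2 + \<alpha> 1, \<alpha> 3, \<alpha> 4] \<and>
      acts_by (s 2) [x, y, z + \<alpha> 2 / w, w, q, p, t]
        [\<alpha> 0, \<alpha> 1 + \<alpha> 2, - \<alpha> 2, \<alpha> 3 + \<alpha> 2, \<alpha> 4] \<and>
      acts_by (s 3) [x, y, z, w - \<alpha> 3 * q / (z * q - 1), q, p - \<alpha> 3 * z / (z * q - 1), t]
        [\<alpha> 0, \<alpha> 1, \<alpha> 2 + \<alpha> 3, - \<alpha> 3, \<alpha> 4 + \<alpha> 3] \<and>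
      acts_by (s 4) [x, y, z, w, q + 2 * \<alpha> 4 / p - t / p^2, p, - t]
        [\<alpha> 0, \<alpha> 1, \<alpha> 2, \<alpha> 3 + 2 * \<alpha> 4, - \<alpha> 4] \<and>
      acts_by \<pi> [- t * q, - p / t, - t / z, (z * w + \<alpha> 2) * z / t, - x / t, - t * y, t]
        [\<alpha> 4, \<alpha> 3, \<alpha> 2, \<alpha> 1, \<alpha> 0] \<and>
      (\<forall>i\<le>4. baecklund_transformation (s i)) \<and> baecklund_transformation \<pi> \<and>
      (\<forall>i\<le>4. s i \<circ> s i = id) \<and>
      (s 0 \<circ> s 1) ^^ 4 = id \<and> (s 3 \<circ> s 4) ^^ 4 = id \<and>
      (s 1 \<circ> s 2) ^^ 3 = id \<and> (s 2 \<circ> s 3) ^^ 3 = id \<and>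
      (\<forall>i\<le>4. \<forall>j\<le>4. \<bar>int i - int j\<bar> \<ge> 2 \<longrightarrow> (s i \<circ> s j) ^^ 2 = id) \<and>
      (\<forall>i\<le>4. \<pi> \<circ> s i \<circ> inv \<pi> = s (4 - i))"
proof -
  define s where "s i = (if i = 0 then s0 else if i = 1 then s1 else if i = 2 then s2
    else if i = 3 then s3 else s4)" for i :: nat
  have s: "s 0 = s0" "s 1 = s1" "s 2 = s2" "s 3 = s3" "s 4 = s4"
    by (simp_all add: s_def)
  have inv_flip: "inv flip = flip"
    using involutions(6) by (intro inv_equality) (simp_all add: fun_eq_iff)
  show ?thesis
    unfolding assms
  proof (intro exI[of _ s] exI[of _ flip] conjI)
    show "\<forall>i\<le>4. baecklund_transformation (s i)"
      unfolding le_4_cases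
      using baecklund_s0 baecklund_s1 baecklund_s2 baecklund_s3 baecklund_s4 by (auto simp only: s)
    show "\<forall>i\<le>4. s i \<circ> s i = id"
      unfolding le_4_cases using involutions by (auto simp only: s)
    show "\<forall>i\<le>4. \<forall>j\<le>4. \<bar>int i - int j\<bar> \<ge> 2 \<longrightarrow> (s i \<circ> s j) ^^ 2 = id"
    proof (intro allI impI)
      fix i j :: nat
      assume "i \<le> 4" "j \<le> 4" "\<bar>int i - int j\<bar> \<ge> 2"
      have commute: "s i \<circ> s j = s j \<circ> s i"
        if "(i, j) \<in> {(0, 2), (0, 3), (0, 4), (1, 3), (1, 4), (2, 4)}" for i j
        using that
        by (elim insertE emptyE) (simp_all only: s prod.inject s0_s2_commute s0_s3_commute
            s0_s4_commute s1_s3_commute s1_s4_commute s2_s4_commute)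
      have "(i, j) \<in> {(0, 2), (0, 3), (0, 4), (1, 3), (1, 4), (2, 4)} \<or>
          (j, i) \<in> {(0, 2), (0, 3), (0, 4), (1, 3), (1, 4), (2, 4)}"
        using \<open>i \<le> 4\<close> \<open>j \<le> 4\<close> \<open>\<bar>int i - int j\<bar> \<ge> 2\<close> unfolding le_4_cases
        by (elim disjE) simp_all
      then have "s i \<circ> s j = s j \<circ> s i"
        by (elim disjE) (rule commute commute[symmetric], assumption)+
      moreover have "s i \<circ> s i = id" "s j \<circ> s j = id"
        using \<open>i \<le> 4\<close> \<open>j \<le> 4\<close> involutions unfolding le_4_cases by (auto simp only: s)
      ultimately show "(s i \<circ> s j) ^^ 2 = id"
        by (intro involutions_power_2)
    qed
    show "\<forall>i\<le>4. flip \<circ> s i \<circ> inv flip = s (4 - i)"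
    proof (intro allI impI)
      fix i :: nat
      assume "i \<le> 4"
      moreover have "s (4 - 0) = s4" "s (4 - 1) = s3" "s (4 - 2) = s2" "s (4 - 3) = s1" "s (4 - 4) = s0"
        by (simp_all add: s_def)
      ultimately show "flip \<circ> s i \<circ> inv flip = s (4 - i)"
        unfolding le_4_cases inv_flip fun_eq_iff comp_apply by (elim disjE) (simp_all only: s conjugates simp_thms)
    qed
    show "(s 0 \<circ> s 1) ^^ 4 = id"
      unfolding s by (intro involutions_power_4 involutions s0_s1_braid)
    show "(s 3 \<circ> s 4) ^^ 4 = id"
      unfolding s by (intro involutions_power_4 involutions s3_s4_braid)
    show "(s 1 \<circ> s 2) ^^ 3 = id"
      unfolding s by (intro involutions_power_3 involutions s1_s2_braid)
    show "(s 2 \<circ> s 3) ^^ 3 = id"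
      unfolding s by (intro involutions_power_3 involutions s2_s3_braid)
  qed (unfold s, (rule acts_s0 acts_s1 acts_s2 acts_s3 acts_s4 acts_flip baecklund_flip)+)
qed

end
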